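(* Let $k$ be a field and let $A$ be an involutive $k$-algebra. Then there is an equivalence of categories between the category $A\text{-}i\mathrm{Bimod}$ of involutive $A$-bimodules and the category $A^{ie}\text{-}\mathrm{Mod}$ of left modules over the involutive enveloping algebra $A^{ie}$ of $A$.
   Context: An involutive vector space is a $k$-vector space $V$ with a linear map $v\mapsto v^*$ satisfying $v^{**}=v$ (the identity is allowed). An involutive $k$-algebra is an associative unital $k$-algebra $A$ that is an involutive vector space with $(ab)^*=b^*a^*$. An involutive $A$-bimodule is an $A$-bimodule $M$ (with $k$ acting centrally) that is an involutive vector space with $(a\cdot m)^*=m^*\cdot a^*$ for all $a\in A$, $m\in M$ (equivalently $(amb)^*=b^*m^*a^*$). Morphisms of involutive bimodules are bimodule homomorphisms commuting with the involutions. Let $A^e=A\otimes_k A^{op}$. The involutive enveloping algebra $A^{ie}$ is the vector space $A^e\otimes_k k[\mathbb{Z}/2]$ with product $(x\otimes\tau^i)\cdot(y\otimes\tau^j)=(x\cdot\tau^i(y))\otimes\tau^{i+j}$, where $\tau$ is the generator of $\mathbb{Z}/2$, acting on $A^e$ by $\tau(a\otimes b)=b^*\otimes a^*$. *)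

theory Defs
  imports "HOL-Algebra.Module" "HOL-Algebra.AbelCoset" "HOL-Algebra.Elementary_Groups"
begin

text \<open>
  All algebraic objects are carrier-based structures in the sense of HOL-Algebra. The locale
  module of that library is a module over a commutative ring, so that field K together
  with module K V is its notion of a vector space. The type ('k, 'v) module is a record type which
  extends that of rings; for structures without a product (vector spaces, modules, bimodules)
  the fields mult and one carry no meaning.
\<close>


section \<open>Categories\<close>

text \<open>
  Composition and the action of a functor on morphisms take the objects involved as arguments,
  since a morphism in Hom X Y is not required to determine X and Y.
\<close>

record ('o, 'h) cat =
  Obj :: "'o set"
  Hom :: "'o \<Rightarrow> 'o \<Rightarrow> 'h set"
  Ident :: "'o \<Rightarrow> 'h"
  Comp :: "'o \<Rightarrow> 'o \<Rightarrow> 'o \<Rightarrow> 'h \<Rightarrow> 'h \<Rightarrow> 'h"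
    \<comment> \<open>Comp C X Y Z g f is g after f, for f in Hom X Y and g in Hom Y Z\<close>

locale category =
  fixes C :: "('o, 'h) cat"
  assumes ident_in_Hom: "X \<in> Obj C \<Longrightarrow> Ident C X \<in> Hom C X X"
    and comp_in_Hom:
      "\<lbrakk>X \<in> Obj C; Y \<in> Obj C; Z \<in> Obj C; f \<in> Hom C X Y; g \<in> Hom C Y Z\<rbrakk>
        \<Longrightarrow> Comp C X Y Z g f \<in> Hom C X Z"
    and comp_ident_right:
      "\<lbrakk>X \<in> Obj C; Y \<in> Obj C; f \<in> Hom C X Y\<rbrakk> \<Longrightarrow> Comp C X X Y f (Ident C X) = f"
    and comp_ident_left:
      "\<lbrakk>X \<in> Obj C; Y \<in> Obj C; f \<in> Hom C X Y\<rbrakk> \<Longrightarrow> Comp C X Y Y (Ident C Y) f = f"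
    and comp_assoc:
      "\<lbrakk>W \<in> Obj C; X \<in> Obj C; Y \<in> Obj C; Z \<in> Obj C;
        f \<in> Hom C W X; g \<in> Hom C X Y; h \<in> Hom C Y Z\<rbrakk>
        \<Longrightarrow> Comp C W X Z (Comp C X Y Z h g) f = Comp C W Y Z h (Comp C W X Y g f)"

record ('o, 'h, 'p, 'i) cat_map =
  on_obj :: "'o \<Rightarrow> 'p"
  on_hom :: "'o \<Rightarrow> 'o \<Rightarrow> 'h \<Rightarrow> 'i"

locale category_functor =
  source: category C + target: category D
  for C :: "('o, 'h) cat" and D :: "('p, 'i) cat" +
  fixes F :: "('o, 'h, 'p, 'i) cat_map"
  assumes on_obj_closed: "X \<in> Obj C \<Longrightarrow> on_obj F X \<in> Obj D"
    and on_hom_closed: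
      "\<lbrakk>X \<in> Obj C; Y \<in> Obj C; f \<in> Hom C X Y\<rbrakk>
        \<Longrightarrow> on_hom F X Y f \<in> Hom D (on_obj F X) (on_obj F Y)"
    and on_hom_ident:
      "X \<in> Obj C \<Longrightarrow> on_hom F X X (Ident C X) = Ident D (on_obj F X)"
    and on_hom_comp:
      "\<lbrakk>X \<in> Obj C; Y \<in> Obj C; Z \<in> Obj C; f \<in> Hom C X Y; g \<in> Hom C Y Z\<rbrakk>
        \<Longrightarrow> on_hom F X Z (Comp C X Y Z g f) =
            Comp D (on_obj F X) (on_obj F Y) (on_obj F Z) (on_hom F Y Z g) (on_hom F X Y f)"

definition id_functor :: "('o, 'h, 'o, 'h) cat_map" where
  "id_functor = \<lparr>on_obj = (\<lambda>X. X), on_hom = (\<lambda>X Y f. f)\<rparr>"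

definition comp_functor ::
  "('p, 'i, 'q, 'j) cat_map \<Rightarrow> ('o, 'h, 'p, 'i) cat_map \<Rightarrow> ('o, 'h, 'q, 'j) cat_map" where
  "comp_functor G F =
    \<lparr>on_obj = (\<lambda>X. on_obj G (on_obj F X)),
     on_hom = (\<lambda>X Y f. on_hom G (on_obj F X) (on_obj F Y) (on_hom F X Y f))\<rparr>"

definition isomorphisms :: "('o, 'h) cat \<Rightarrow> 'o \<Rightarrow> 'o \<Rightarrow> 'h set" where
  "isomorphisms C X Y =
    {f \<in> Hom C X Y. \<exists>g \<in> Hom C Y X.
       Comp C X Y X g f = Ident C X \<and> Comp C Y X Y f g = Ident C Y}"

definition natural_isomorphism ::
  "('o, 'h) cat \<Rightarrow> ('p, 'i) cat \<Rightarrow> ('o, 'h, 'p, 'i) cat_map \<Rightarrow> ('o, 'h, 'p, 'i) cat_map \<Rightarrow>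
    ('o \<Rightarrow> 'i) \<Rightarrow> bool" where
  "natural_isomorphism C D F G \<eta> \<longleftrightarrow>
    (\<forall>X \<in> Obj C. \<eta> X \<in> isomorphisms D (on_obj F X) (on_obj G X)) \<and>
    (\<forall>X \<in> Obj C. \<forall>Y \<in> Obj C. \<forall>f \<in> Hom C X Y.
       Comp D (on_obj F X) (on_obj F Y) (on_obj G Y) (\<eta> Y) (on_hom F X Y f) =
       Comp D (on_obj F X) (on_obj G X) (on_obj G Y) (on_hom G X Y f) (\<eta> X))"

definition equivalent_categories :: "('o, 'h) cat \<Rightarrow> ('p, 'i) cat \<Rightarrow> bool" where
  "equivalent_categories C D \<longleftrightarrow>
    (\<exists>F G \<eta> \<epsilon>. category_functor C D F \<and> category_functor D C G \<and>
       natural_isomorphism C C id_functor (comp_functor G F) \<eta> \<and>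
       natural_isomorphism D D (comp_functor F G) id_functor \<epsilon>)"


section \<open>Free modules and tensor products\<close>

definition free_module :: "('k, 'x) ring_scheme \<Rightarrow> 's set \<Rightarrow> ('k, 's \<Rightarrow> 'k) module" where
  "free_module K S =
    \<lparr>carrier = {f. (\<forall>s. f s \<in> carrier K) \<and> (\<forall>s. s \<notin> S \<longrightarrow> f s = \<zero>\<^bsub>K\<^esub>) \<and>
                   finite {s. f s \<noteq> \<zero>\<^bsub>K\<^esub>}},
     monoid.mult = undefined, one = undefined,
     zero = (\<lambda>s. \<zero>\<^bsub>K\<^esub>), add = (\<lambda>f g s. f s \<oplus>\<^bsub>K\<^esub> g s),
     smult = (\<lambda>r f s. r \<otimes>\<^bsub>K\<^esub> f s)\<rparr>"

definition free_basis :: "('k, 'x) ring_scheme \<Rightarrow> 's \<Rightarrow> 's \<Rightarrow> 'k" where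
  "free_basis K s = (\<lambda>t. if t = s then \<one>\<^bsub>K\<^esub> else \<zero>\<^bsub>K\<^esub>)"

text \<open>The K-linear map from a free module to U which sends each basis element s to phi s.\<close>

definition free_lift ::
  "('k, 'x) ring_scheme \<Rightarrow> ('k, 'u, 'y) module_scheme \<Rightarrow> ('s \<Rightarrow> 'u) \<Rightarrow> ('s \<Rightarrow> 'k) \<Rightarrow> 'u" where
  "free_lift K U \<phi> f = (\<Oplus>\<^bsub>U\<^esub>s \<in> {s. f s \<noteq> \<zero>\<^bsub>K\<^esub>}. f s \<odot>\<^bsub>U\<^esub> \<phi> s)"

text \<open>
  The tensor product of V and W over K is the quotient of the free module on the set of all
  pairs (v, w) by the submodule generated by the bilinearity relations; its elements are cosets.
\<close>

definition tensor_generators ::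
  "('k, 'x) ring_scheme \<Rightarrow> ('k, 'v, 'y) module_scheme \<Rightarrow> ('k, 'w, 'z) module_scheme \<Rightarrow>
    ('v \<times> 'w \<Rightarrow> 'k) set" where
  "tensor_generators K V W =
    (let F = free_module K (carrier V \<times> carrier W); b = (\<lambda>v w. free_basis K (v, w)) in
      {b (v \<oplus>\<^bsub>V\<^esub> v') w \<ominus>\<^bsub>F\<^esub> (b v w \<oplus>\<^bsub>F\<^esub> b v' w) | v v' w.
         v \<in> carrier V \<and> v' \<in> carrier V \<and> w \<in> carrier W} \<union>
      {b v (w \<oplus>\<^bsub>W\<^esub> w') \<ominus>\<^bsub>F\<^esub> (b v w \<oplus>\<^bsub>F\<^esub> b v w') | v w w'.
         v \<in> carrier V \<and> w \<in> carrier W \<and> w' \<in> carrier W} \<union>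
      {b (r \<odot>\<^bsub>V\<^esub> v) w \<ominus>\<^bsub>F\<^esub> r \<odot>\<^bsub>F\<^esub> b v w | r v w.
         r \<in> carrier K \<and> v \<in> carrier V \<and> w \<in> carrier W} \<union>
      {b v (r \<odot>\<^bsub>W\<^esub> w) \<ominus>\<^bsub>F\<^esub> r \<odot>\<^bsub>F\<^esub> b v w | r v w.
         r \<in> carrier K \<and> v \<in> carrier V \<and> w \<in> carrier W})"

definition tensor_relations ::
  "('k, 'x) ring_scheme \<Rightarrow> ('k, 'v, 'y) module_scheme \<Rightarrow> ('k, 'w, 'z) module_scheme \<Rightarrow>
    ('v \<times> 'w \<Rightarrow> 'k) set" where
  "tensor_relations K V W =
    \<Inter>{N. submodule N K (free_module K (carrier V \<times> carrier W)) \<and> tensor_generators K V W \<subseteq> N}"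

type_synonym ('k, 'v, 'w) tensor = "('v \<times> 'w \<Rightarrow> 'k) set"

definition tensor_product ::
  "('k, 'x) ring_scheme \<Rightarrow> ('k, 'v, 'y) module_scheme \<Rightarrow> ('k, 'w, 'z) module_scheme \<Rightarrow>
    ('k, ('k, 'v, 'w) tensor) module" where
  "tensor_product K V W =
    (let F = free_module K (carrier V \<times> carrier W); N = tensor_relations K V W in
      \<lparr>carrier = a_rcosets\<^bsub>F\<^esub> N,
       monoid.mult = undefined, one = undefined,
       zero = N, add = (\<lambda>X Y. X <+>\<^bsub>F\<^esub> Y),
       smult = (\<lambda>r X. \<Union>f\<in>X. N +>\<^bsub>F\<^esub> (r \<odot>\<^bsub>F\<^esub> f))\<rparr>)"

definition pure_tensor ::
  "('k, 'x) ring_scheme \<Rightarrow> ('k, 'v, 'y) module_scheme \<Rightarrow> ('k, 'w, 'z) module_scheme \<Rightarrow>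
    'v \<Rightarrow> 'w \<Rightarrow> ('k, 'v, 'w) tensor" where
  "pure_tensor K V W v w =
    tensor_relations K V W +>\<^bsub>free_module K (carrier V \<times> carrier W)\<^esub> free_basis K (v, w)"

text \<open>
  The linear map from a tensor product to U which is induced by a bilinear map phi, i.e. which
  sends the pure tensor of v and w to phi v w; by bilinearity of phi the choice of the
  representative is irrelevant.
\<close>

definition tensor_lift ::
  "('k, 'x) ring_scheme \<Rightarrow> ('k, 'u, 'y) module_scheme \<Rightarrow> ('v \<Rightarrow> 'w \<Rightarrow> 'u) \<Rightarrow>
    ('k, 'v, 'w) tensor \<Rightarrow> 'u" where
  "tensor_lift K U \<phi> X = free_lift K U (\<lambda>(v, w). \<phi> v w) (SOME f. f \<in> X)"


section \<open>Algebras and the enveloping algebra\<close>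

text \<open>The locale algebra of HOL-Algebra covers commutative algebras only.\<close>

locale assoc_algebra = module K A + A?: ring A for K (structure) and A (structure) +
  assumes smult_mult_left:
      "\<lbrakk>r \<in> carrier K; a \<in> carrier A; b \<in> carrier A\<rbrakk>
        \<Longrightarrow> (r \<odot>\<^bsub>A\<^esub> a) \<otimes>\<^bsub>A\<^esub> b = r \<odot>\<^bsub>A\<^esub> (a \<otimes>\<^bsub>A\<^esub> b)"
    and smult_mult_right:
      "\<lbrakk>r \<in> carrier K; a \<in> carrier A; b \<in> carrier A\<rbrakk>
        \<Longrightarrow> a \<otimes>\<^bsub>A\<^esub> (r \<odot>\<^bsub>A\<^esub> b) = r \<odot>\<^bsub>A\<^esub> (a \<otimes>\<^bsub>A\<^esub> b)"

definition opposite :: "('a, 'x) monoid_scheme \<Rightarrow> ('a, 'x) monoid_scheme" where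
  "opposite A = A\<lparr>monoid.mult := (\<lambda>x y. y \<otimes>\<^bsub>A\<^esub> x)\<rparr>"

definition algebra_tensor ::
  "('k, 'x) ring_scheme \<Rightarrow> ('k, 'a, 'y) module_scheme \<Rightarrow> ('k, 'b, 'z) module_scheme \<Rightarrow>
    ('k, ('k, 'a, 'b) tensor) module" where
  "algebra_tensor K A B =
    (let T = tensor_product K A B in
      T\<lparr>monoid.mult := (\<lambda>X Y.
          tensor_lift K T (\<lambda>a b.
            tensor_lift K T (\<lambda>a' b'. pure_tensor K A B (a \<otimes>\<^bsub>A\<^esub> a') (b \<otimes>\<^bsub>B\<^esub> b')) Y) X),
        one := pure_tensor K A B \<one>\<^bsub>A\<^esub> \<one>\<^bsub>B\<^esub>\<rparr>)"

definition enveloping_algebra ::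
  "('k, 'x) ring_scheme \<Rightarrow> ('k, 'a, 'y) module_scheme \<Rightarrow> ('k, ('k, 'a, 'a) tensor) module" where
  "enveloping_algebra K A = algebra_tensor K A (opposite A)"


section \<open>Involutive structures\<close>

record ('k, 'v) involutive_space = "('k, 'v) module" +
  star :: "'v \<Rightarrow> 'v"

locale involutive_vector_space = field K + module K V for K (structure) and V (structure) +
  assumes star_closed: "v \<in> carrier V \<Longrightarrow> star V v \<in> carrier V"
    and star_add:
      "\<lbrakk>v \<in> carrier V; w \<in> carrier V\<rbrakk> \<Longrightarrow> star V (v \<oplus>\<^bsub>V\<^esub> w) = star V v \<oplus>\<^bsub>V\<^esub> star V w"
    and star_smult:
      "\<lbrakk>r \<in> carrier K; v \<in> carrier V\<rbrakk> \<Longrightarrow> star V (r \<odot>\<^bsub>V\<^esub> v) = r \<odot>\<^bsub>V\<^esub> star V v"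
    and star_star: "v \<in> carrier V \<Longrightarrow> star V (star V v) = v"

locale involutive_algebra =
  involutive_vector_space K A + assoc_algebra K A for K (structure) and A (structure) +
  assumes star_mult:
      "\<lbrakk>a \<in> carrier A; b \<in> carrier A\<rbrakk> \<Longrightarrow> star A (a \<otimes>\<^bsub>A\<^esub> b) = star A b \<otimes>\<^bsub>A\<^esub> star A a"

record ('k, 'a, 'm) involutive_bimod = "('k, 'm) involutive_space" +
  lact :: "'a \<Rightarrow> 'm \<Rightarrow> 'm"
  ract :: "'m \<Rightarrow> 'a \<Rightarrow> 'm"

text \<open>
  The field K acts centrally: both actions are K-bilinear, so that the scalar multiplication by r
  is the left as well as the right action of r times the unit of A.
\<close>

locale involutive_bimodule =
  A: involutive_algebra K A + M: involutive_vector_space K M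
  for K :: "('k, 'x) ring_scheme" and A :: "('k, 'a, 'y) involutive_space_scheme"
    and M :: "('k, 'a, 'm, 'z) involutive_bimod_scheme" +
  assumes lact_closed: "\<lbrakk>a \<in> carrier A; m \<in> carrier M\<rbrakk> \<Longrightarrow> lact M a m \<in> carrier M"
    and ract_closed: "\<lbrakk>a \<in> carrier A; m \<in> carrier M\<rbrakk> \<Longrightarrow> ract M m a \<in> carrier M"
    and lact_add_left:
      "\<lbrakk>a \<in> carrier A; b \<in> carrier A; m \<in> carrier M\<rbrakk>
        \<Longrightarrow> lact M (a \<oplus>\<^bsub>A\<^esub> b) m = lact M a m \<oplus>\<^bsub>M\<^esub> lact M b m"
    and lact_add_right:
      "\<lbrakk>a \<in> carrier A; m \<in> carrier M; n \<in> carrier M\<rbrakk>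
        \<Longrightarrow> lact M a (m \<oplus>\<^bsub>M\<^esub> n) = lact M a m \<oplus>\<^bsub>M\<^esub> lact M a n"
    and lact_smult_left:
      "\<lbrakk>r \<in> carrier K; a \<in> carrier A; m \<in> carrier M\<rbrakk>
        \<Longrightarrow> lact M (r \<odot>\<^bsub>A\<^esub> a) m = r \<odot>\<^bsub>M\<^esub> lact M a m"
    and lact_smult_right:
      "\<lbrakk>r \<in> carrier K; a \<in> carrier A; m \<in> carrier M\<rbrakk>
        \<Longrightarrow> lact M a (r \<odot>\<^bsub>M\<^esub> m) = r \<odot>\<^bsub>M\<^esub> lact M a m"
    and lact_mult:
      "\<lbrakk>a \<in> carrier A; b \<in> carrier A; m \<in> carrier M\<rbrakk>
        \<Longrightarrow> lact M (a \<otimes>\<^bsub>A\<^esub> b) m = lact M a (lact M b m)"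
    and lact_one: "m \<in> carrier M \<Longrightarrow> lact M \<one>\<^bsub>A\<^esub> m = m"
    and ract_add_left:
      "\<lbrakk>a \<in> carrier A; m \<in> carrier M; n \<in> carrier M\<rbrakk>
        \<Longrightarrow> ract M (m \<oplus>\<^bsub>M\<^esub> n) a = ract M m a \<oplus>\<^bsub>M\<^esub> ract M n a"
    and ract_add_right:
      "\<lbrakk>a \<in> carrier A; b \<in> carrier A; m \<in> carrier M\<rbrakk>
        \<Longrightarrow> ract M m (a \<oplus>\<^bsub>A\<^esub> b) = ract M m a \<oplus>\<^bsub>M\<^esub> ract M m b"
    and ract_smult_left:
      "\<lbrakk>r \<in> carrier K; a \<in> carrier A; m \<in> carrier M\<rbrakk>
        \<Longrightarrow> ract M (r \<odot>\<^bsub>M\<^esub> m) a = r \<odot>\<^bsub>M\<^esub> ract M m a"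
    and ract_smult_right:
      "\<lbrakk>r \<in> carrier K; a \<in> carrier A; m \<in> carrier M\<rbrakk>
        \<Longrightarrow> ract M m (r \<odot>\<^bsub>A\<^esub> a) = r \<odot>\<^bsub>M\<^esub> ract M m a"
    and ract_mult:
      "\<lbrakk>a \<in> carrier A; b \<in> carrier A; m \<in> carrier M\<rbrakk>
        \<Longrightarrow> ract M m (a \<otimes>\<^bsub>A\<^esub> b) = ract M (ract M m a) b"
    and ract_one: "m \<in> carrier M \<Longrightarrow> ract M m \<one>\<^bsub>A\<^esub> = m"
    and lact_ract:
      "\<lbrakk>a \<in> carrier A; b \<in> carrier A; m \<in> carrier M\<rbrakk>
        \<Longrightarrow> ract M (lact M a m) b = lact M a (ract M m b)"
    and star_lact:
      "\<lbrakk>a \<in> carrier A; m \<in> carrier M\<rbrakk> \<Longrightarrow> star M (lact M a m) = ract M (star M m) (star A a)"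

definition involutive_bimodule_hom ::
  "('k, 'x) ring_scheme \<Rightarrow> ('k, 'a, 'y) involutive_space_scheme \<Rightarrow>
    ('k, 'a, 'm, 'z) involutive_bimod_scheme \<Rightarrow> ('k, 'a, 'n, 'w) involutive_bimod_scheme \<Rightarrow>
    ('m \<Rightarrow> 'n) set" where
  "involutive_bimodule_hom K A M N =
    {f \<in> carrier M \<rightarrow>\<^sub>E carrier N.
      (\<forall>m \<in> carrier M. \<forall>m' \<in> carrier M. f (m \<oplus>\<^bsub>M\<^esub> m') = f m \<oplus>\<^bsub>N\<^esub> f m') \<and>
      (\<forall>r \<in> carrier K. \<forall>m \<in> carrier M. f (r \<odot>\<^bsub>M\<^esub> m) = r \<odot>\<^bsub>N\<^esub> f m) \<and>
      (\<forall>a \<in> carrier A. \<forall>m \<in> carrier M. f (lact M a m) = lact N a (f m)) \<and>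
      (\<forall>a \<in> carrier A. \<forall>m \<in> carrier M. f (ract M m a) = ract N (f m) a) \<and>
      (\<forall>m \<in> carrier M. f (star M m) = star N (f m))}"

definition involutive_bimodule_category ::
  "('k, 'x) ring_scheme \<Rightarrow> ('k, 'a, 'y) involutive_space_scheme \<Rightarrow>
    (('k, 'a, 'm) involutive_bimod, 'm \<Rightarrow> 'm) cat" where
  "involutive_bimodule_category K A =
    \<lparr>Obj = {M. involutive_bimodule K A M},
     Hom = involutive_bimodule_hom K A,
     Ident = (\<lambda>M. \<lambda>m \<in> carrier M. m),
     Comp = (\<lambda>L M N g f. compose (carrier L) g f)\<rparr>"


section \<open>The involutive enveloping algebra\<close>

definition envelope_flip ::
  "('k, 'x) ring_scheme \<Rightarrow> ('k, 'a, 'y) involutive_space_scheme \<Rightarrow>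
    ('k, 'a, 'a) tensor \<Rightarrow> ('k, 'a, 'a) tensor" where
  "envelope_flip K A =
    tensor_lift K (enveloping_algebra K A)
      (\<lambda>a b. pure_tensor K A (opposite A) (star A b) (star A a))"

abbreviation Z2 :: "int monoid" where
  "Z2 \<equiv> integer_mod_group 2"

text \<open>
  The group algebra of Z/2 enters only as a vector space, the free module on the group elements
  0 and 1; the basis element of i is the i-th power of the generator. The product is the
  bilinear extension of the rule
  (x, tau^i) (y, tau^j) = (x tau^i(y), tau^(i+j)) in both arguments.
\<close>

definition involutive_enveloping_algebra ::
  "('k, 'x) ring_scheme \<Rightarrow> ('k, 'a, 'y) involutive_space_scheme \<Rightarrow>
    ('k, ('k, ('k, 'a, 'a) tensor, int \<Rightarrow> 'k) tensor) module" where
  "involutive_enveloping_algebra K A =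
    (let E = enveloping_algebra K A; G = free_module K (carrier Z2);
         T = tensor_product K E G; \<tau> = envelope_flip K A in
      T\<lparr>monoid.mult := (\<lambda>X Y.
          tensor_lift K T (\<lambda>x u.
            tensor_lift K T (\<lambda>y v.
              free_lift K T (\<lambda>i.
                free_lift K T (\<lambda>j.
                  pure_tensor K E G (x \<otimes>\<^bsub>E\<^esub> (\<tau> ^^ nat i) y) (free_basis K (i \<otimes>\<^bsub>Z2\<^esub> j))) v) u) Y) X),
        one := pure_tensor K E G \<one>\<^bsub>E\<^esub> (free_basis K \<one>\<^bsub>Z2\<^esub>)\<rparr>)"


section \<open>Left modules\<close>

locale left_module = R: ring R + M: abelian_group M
  for R :: "('r, 'x) ring_scheme" and M :: "('r, 'm, 'z) module_scheme" +
  assumes smult_closed: "\<lbrakk>r \<in> carrier R; m \<in> carrier M\<rbrakk> \<Longrightarrow> r \<odot>\<^bsub>M\<^esub> m \<in> carrier M"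
    and smult_l_distr:
      "\<lbrakk>r \<in> carrier R; s \<in> carrier R; m \<in> carrier M\<rbrakk>
        \<Longrightarrow> (r \<oplus>\<^bsub>R\<^esub> s) \<odot>\<^bsub>M\<^esub> m = r \<odot>\<^bsub>M\<^esub> m \<oplus>\<^bsub>M\<^esub> s \<odot>\<^bsub>M\<^esub> m"
    and smult_r_distr:
      "\<lbrakk>r \<in> carrier R; m \<in> carrier M; n \<in> carrier M\<rbrakk>
        \<Longrightarrow> r \<odot>\<^bsub>M\<^esub> (m \<oplus>\<^bsub>M\<^esub> n) = r \<odot>\<^bsub>M\<^esub> m \<oplus>\<^bsub>M\<^esub> r \<odot>\<^bsub>M\<^esub> n"
    and smult_assoc:
      "\<lbrakk>r \<in> carrier R; s \<in> carrier R; m \<in> carrier M\<rbrakk>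
        \<Longrightarrow> (r \<otimes>\<^bsub>R\<^esub> s) \<odot>\<^bsub>M\<^esub> m = r \<odot>\<^bsub>M\<^esub> (s \<odot>\<^bsub>M\<^esub> m)"
    and smult_one: "m \<in> carrier M \<Longrightarrow> \<one>\<^bsub>R\<^esub> \<odot>\<^bsub>M\<^esub> m = m"

definition left_module_hom ::
  "('r, 'x) ring_scheme \<Rightarrow> ('r, 'm, 'y) module_scheme \<Rightarrow> ('r, 'n, 'z) module_scheme \<Rightarrow>
    ('m \<Rightarrow> 'n) set" where
  "left_module_hom R M N =
    {f \<in> carrier M \<rightarrow>\<^sub>E carrier N.
      (\<forall>m \<in> carrier M. \<forall>m' \<in> carrier M. f (m \<oplus>\<^bsub>M\<^esub> m') = f m \<oplus>\<^bsub>N\<^esub> f m') \<and>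
      (\<forall>r \<in> carrier R. \<forall>m \<in> carrier M. f (r \<odot>\<^bsub>M\<^esub> m) = r \<odot>\<^bsub>N\<^esub> f m)}"

definition left_module_category ::
  "('r, 'x) ring_scheme \<Rightarrow> (('r, 'm) module, 'm \<Rightarrow> 'm) cat" where
  "left_module_category R =
    \<lparr>Obj = {M. left_module R M},
     Hom = left_module_hom R,
     Ident = (\<lambda>M. \<lambda>m \<in> carrier M. m),
     Comp = (\<lambda>L M N g f. compose (carrier L) g f)\<rparr>"

end

theory Submission
  imports Defs
begin

text \<open>
  An involutive bimodule M becomes a module over the involutive enveloping algebra by letting
  $(a \otimes b) \otimes \tau^i$ send m to $a \cdot \tau^i(m) \cdot b$, where $\tau(m) = m^*$.
  Conversely, a module becomes a bimodule through the elements $(a \otimes 1) \otimes 1$,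
  $(1 \otimes b) \otimes 1$ and $(1 \otimes 1) \otimes \tau$. Neither construction changes the
  underlying abelian group or the maps, so the unit and the counit are identity maps. Since the
  elements $(a \otimes b) \otimes \tau^i$ generate the enveloping algebra additively,
  associativity, compatibility with morphisms and the agreement of two actions need to be checked
  on them only.
\<close>

section \<open>Linear and bilinear maps\<close>

definition linear_map ::
  "('k, 'x) ring_scheme \<Rightarrow> ('k, 'v, 'y) module_scheme \<Rightarrow> ('k, 'u, 'z) module_scheme \<Rightarrow>
    ('v \<Rightarrow> 'u) \<Rightarrow> bool" where
  "linear_map K V U f \<longleftrightarrow>
    (\<forall>v\<in>carrier V. f v \<in> carrier U) \<and>
    (\<forall>v\<in>carrier V. \<forall>w\<in>carrier V. f (v \<oplus>\<^bsub>V\<^esub> w) = f v \<oplus>\<^bsub>U\<^esub> f w) \<and>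
    (\<forall>r\<in>carrier K. \<forall>v\<in>carrier V. f (r \<odot>\<^bsub>V\<^esub> v) = r \<odot>\<^bsub>U\<^esub> f v)"

definition bilinear_map ::
  "('k, 'x) ring_scheme \<Rightarrow> ('k, 'v, 'y) module_scheme \<Rightarrow> ('k, 'w, 'y1) module_scheme \<Rightarrow>
    ('k, 'u, 'z) module_scheme \<Rightarrow> ('v \<Rightarrow> 'w \<Rightarrow> 'u) \<Rightarrow> bool" where
  "bilinear_map K V W U \<phi> \<longleftrightarrow>
    (\<forall>v\<in>carrier V. linear_map K W U (\<phi> v)) \<and>
    (\<forall>w\<in>carrier W. linear_map K V U (\<lambda>v. \<phi> v w))"

lemma linear_mapI:
  assumes "\<And>v. v \<in> carrier V \<Longrightarrow> f v \<in> carrier U"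
    and "\<And>v w. v \<in> carrier V \<Longrightarrow> w \<in> carrier V \<Longrightarrow> f (v \<oplus>\<^bsub>V\<^esub> w) = f v \<oplus>\<^bsub>U\<^esub> f w"
    and "\<And>r v. r \<in> carrier K \<Longrightarrow> v \<in> carrier V \<Longrightarrow> f (r \<odot>\<^bsub>V\<^esub> v) = r \<odot>\<^bsub>U\<^esub> f v"
  shows "linear_map K V U f"
  using assms by (simp add: linear_map_def)

lemma linear_mapD:
  assumes "linear_map K V U f"
  shows "v \<in> carrier V \<Longrightarrow> f v \<in> carrier U"
    and "v \<in> carrier V \<Longrightarrow> w \<in> carrier V \<Longrightarrow> f (v \<oplus>\<^bsub>V\<^esub> w) = f v \<oplus>\<^bsub>U\<^esub> f w"
    and "r \<in> carrier K \<Longrightarrow> v \<in> carrier V \<Longrightarrow> f (r \<odot>\<^bsub>V\<^esub> v) = r \<odot>\<^bsub>U\<^esub> f v"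
  using assms by (simp_all add: linear_map_def)

lemma bilinear_mapI:
  assumes "\<And>v. v \<in> carrier V \<Longrightarrow> linear_map K W U (\<phi> v)"
    and "\<And>w. w \<in> carrier W \<Longrightarrow> linear_map K V U (\<lambda>v. \<phi> v w)"
  shows "bilinear_map K V W U \<phi>"
  using assms by (simp add: bilinear_map_def)

lemma bilinear_mapD:
  assumes "bilinear_map K V W U \<phi>"
  shows "v \<in> carrier V \<Longrightarrow> linear_map K W U (\<phi> v)"
    and "w \<in> carrier W \<Longrightarrow> linear_map K V U (\<lambda>v. \<phi> v w)"
  using assms by (simp_all add: bilinear_map_def)

lemma linear_map_comp:
  assumes "linear_map K V U f" and "linear_map K U X g"
  shows "linear_map K V X (\<lambda>v. g (f v))"
  using assms by (simp add: linear_map_def)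

lemma linear_map_submodule_kernel:
  assumes "module K V" and "module K U" and f: "linear_map K V U f"
  shows "submodule {v \<in> carrier V. f v = \<zero>\<^bsub>U\<^esub>} K V"
proof -
  interpret V: module K V by fact
  interpret U: module K U by fact
  note D = linear_mapD[OF f]
  have z: "f \<zero>\<^bsub>V\<^esub> = \<zero>\<^bsub>U\<^esub>"
    using D(3)[of "\<zero>\<^bsub>K\<^esub>" "\<zero>\<^bsub>V\<^esub>"] D(1)[of "\<zero>\<^bsub>V\<^esub>"] by simp
  have m: "f (\<ominus>\<^bsub>V\<^esub> v) = \<ominus>\<^bsub>U\<^esub> f v" if "v \<in> carrier V" for v
    using that D(2)[of "\<ominus>\<^bsub>V\<^esub> v" v] D(1)[of v] D(1)[of "\<ominus>\<^bsub>V\<^esub> v"] z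
    by (simp add: V.l_neg U.M.minus_equality)
  show ?thesis
    by (rule V.submoduleI) (auto simp: z m D)
qed

section \<open>Free modules\<close>

lemma free_module_simps [simp]:
  "zero (free_module K S) = (\<lambda>s. \<zero>\<^bsub>K\<^esub>)"
  "f \<oplus>\<^bsub>free_module K S\<^esub> g = (\<lambda>s. f s \<oplus>\<^bsub>K\<^esub> g s)"
  "r \<odot>\<^bsub>free_module K S\<^esub> f = (\<lambda>s. r \<otimes>\<^bsub>K\<^esub> f s)"
  by (simp_all add: free_module_def)

lemma mem_free_module:
  "f \<in> carrier (free_module K S) \<longleftrightarrow>
    (\<forall>s. f s \<in> carrier K) \<and> (\<forall>s. s \<notin> S \<longrightarrow> f s = \<zero>\<^bsub>K\<^esub>) \<and> finite {s. f s \<noteq> \<zero>\<^bsub>K\<^esub>}"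
  by (simp add: free_module_def)

context cring
begin

lemma free_module_module: "module R (free_module R S)"
proof (intro moduleI abelian_groupI, goal_cases)
  case (2 f g)
  have "{s. f s \<oplus> g s \<noteq> \<zero>} \<subseteq> {s. f s \<noteq> \<zero>} \<union> {s. g s \<noteq> \<zero>}" by auto
  with 2 show ?case by (auto simp: mem_free_module elim: finite_subset)
next
  case (7 f)
  have "(\<lambda>s. \<ominus> f s) \<in> carrier (free_module R S)"
    using 7 by (auto simp: mem_free_module elim!: rev_finite_subset)
  then show ?case
    using 7 by (intro bexI[of _ "\<lambda>s. \<ominus> f s"]) (auto simp: mem_free_module l_neg)
next
  case (8 r f)
  have "{s. r \<otimes> f s \<noteq> \<zero>} \<subseteq> {s. f s \<noteq> \<zero>}" using 8 by auto
  with 8 show ?case by (auto simp: mem_free_module elim: finite_subset)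
qed (auto simp: mem_free_module a_ac l_distr r_distr m_assoc is_cring)

lemma free_basis_closed [simp]: "s \<in> S \<Longrightarrow> free_basis R s \<in> carrier (free_module R S)"
  by (auto simp: mem_free_module free_basis_def)

lemma free_module_induct [consumes 1, case_names zero smult_basis add]:
  assumes "f \<in> carrier (free_module R S)"
    and "P (\<lambda>s. \<zero>)"
    and "\<And>r s. r \<in> carrier R \<Longrightarrow> s \<in> S \<Longrightarrow> P (r \<odot>\<^bsub>free_module R S\<^esub> free_basis R s)"
    and add: "\<And>f g. f \<in> carrier (free_module R S) \<Longrightarrow> g \<in> carrier (free_module R S) \<Longrightarrow>
      P f \<Longrightarrow> P g \<Longrightarrow> P (f \<oplus>\<^bsub>free_module R S\<^esub> g)"
  shows "P f"
proof -
  interpret F: module R "free_module R S" by (rule free_module_module)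
  have "P f" if "finite B" "f \<in> carrier (free_module R S)" "{s. f s \<noteq> \<zero>} \<subseteq> B" for B f
    using that
  proof (induction B arbitrary: f)
    case empty
    then have "f = (\<lambda>s. \<zero>)" by auto
    then show ?case using assms(2) by simp
  next
    case (insert t B)
    show ?case
    proof (cases "f t = \<zero>")
      case True
      then show ?thesis using insert by (metis (mono_tags, lifting) mem_Collect_eq subset_insert)
    next
      case False
      have t: "t \<in> S" and ft: "f t \<in> carrier R" and fc: "\<And>s. f s \<in> carrier R"
        using False insert.prems(1) by (auto simp: mem_free_module)
      define g where "g = f(t := \<zero>)"
      have sub: "{s. g s \<noteq> \<zero>} \<subseteq> B" using insert.prems(2) by (auto simp: g_def)
      have g: "g \<in> carrier (free_module R S)"
        using insert.prems(1) sub finite_subset[OF sub insert.hyps(1)]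
        by (auto simp: mem_free_module g_def)
      have "f = f t \<odot>\<^bsub>free_module R S\<^esub> free_basis R t \<oplus>\<^bsub>free_module R S\<^esub> g"
        using fc by (auto simp: g_def free_basis_def)
      moreover have "P (f t \<odot>\<^bsub>free_module R S\<^esub> free_basis R t \<oplus>\<^bsub>free_module R S\<^esub> g)"
        by (rule add) (use t ft g assms(3) insert.IH[OF g sub] in
            \<open>auto simp del: free_module_simps\<close>)
      ultimately show ?thesis by simp
    qed
  qed
  then show ?thesis using assms(1) by (auto simp: mem_free_module)
qed

end

context module
begin

lemma free_lift_superset:
  assumes "f \<in> carrier (free_module R S)" and "\<phi> \<in> S \<rightarrow> carrier M"
    and "finite B" and "{s. f s \<noteq> \<zero>} \<subseteq> B" and "B \<subseteq> S"
  shows "free_lift R M \<phi> f = (\<Oplus>\<^bsub>M\<^esub>s\<in>B. f s \<odot>\<^bsub>M\<^esub> \<phi> s)"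
  unfolding free_lift_def
  using assms by (intro M.add.finprod_mono_neutral_cong_left) (auto simp: mem_free_module Pi_def)

lemma free_lift_linear:
  assumes \<phi>: "\<phi> \<in> S \<rightarrow> carrier M"
  shows "linear_map R (free_module R S) M (free_lift R M \<phi>)"
proof (rule linear_mapI)
  interpret F: module R "free_module R S" by (rule R.free_module_module)
  have supp: "finite {s. f s \<noteq> \<zero>}" "{s. f s \<noteq> \<zero>} \<subseteq> S" "\<And>s. f s \<in> carrier R"
    if "f \<in> carrier (free_module R S)" for f
    using that by (auto simp: mem_free_module)
  fix f assume f: "f \<in> carrier (free_module R S)"
  then show "free_lift R M \<phi> f \<in> carrier M"
    unfolding free_lift_def using \<phi> supp[OF f]
    by (intro M.finsum_closed) (auto simp: Pi_def)
  fix g assume g: "g \<in> carrier (free_module R S)"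
  let ?B = "{s. f s \<noteq> \<zero>} \<union> {s. g s \<noteq> \<zero>}"
  note B = free_lift_superset[where B = ?B, OF _ \<phi>]
  have c: "\<And>h. h \<in> carrier (free_module R S) \<Longrightarrow> (\<lambda>s. h s \<odot>\<^bsub>M\<^esub> \<phi> s) \<in> ?B \<rightarrow> carrier M"
    using \<phi> supp(2)[OF f] supp(2)[OF g] supp(3) by (auto simp: Pi_def)
  have "free_lift R M \<phi> (f \<oplus>\<^bsub>free_module R S\<^esub> g) =
      (\<Oplus>\<^bsub>M\<^esub>s\<in>?B. (f s \<oplus> g s) \<odot>\<^bsub>M\<^esub> \<phi> s)"
    using F.a_closed[OF f g] supp[OF f] supp[OF g] by (subst B) auto
  also have "\<dots> = (\<Oplus>\<^bsub>M\<^esub>s\<in>?B. f s \<odot>\<^bsub>M\<^esub> \<phi> s \<oplus>\<^bsub>M\<^esub> g s \<odot>\<^bsub>M\<^esub> \<phi> s)"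
    using \<phi> supp[OF f] supp[OF g]
    by (intro M.finsum_cong') (auto simp: Pi_def smult_l_distr)
  also have "\<dots> = (\<Oplus>\<^bsub>M\<^esub>s\<in>?B. f s \<odot>\<^bsub>M\<^esub> \<phi> s) \<oplus>\<^bsub>M\<^esub> (\<Oplus>\<^bsub>M\<^esub>s\<in>?B. g s \<odot>\<^bsub>M\<^esub> \<phi> s)"
    by (intro M.finsum_addf c f g)
  also have "\<dots> = free_lift R M \<phi> f \<oplus>\<^bsub>M\<^esub> free_lift R M \<phi> g"
    using f g supp[OF f] supp[OF g] by (subst (1 2) B) auto
  finally show "free_lift R M \<phi> (f \<oplus>\<^bsub>free_module R S\<^esub> g) =
      free_lift R M \<phi> f \<oplus>\<^bsub>M\<^esub> free_lift R M \<phi> g" .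
next
  interpret F: module R "free_module R S" by (rule R.free_module_module)
  fix r f assume r: "r \<in> carrier R" and f: "f \<in> carrier (free_module R S)"
  let ?B = "{s. f s \<noteq> \<zero>}"
  have supp: "finite ?B" "?B \<subseteq> S" "\<And>s. f s \<in> carrier R"
    using f by (auto simp: mem_free_module)
  have "free_lift R M \<phi> (r \<odot>\<^bsub>free_module R S\<^esub> f) = (\<Oplus>\<^bsub>M\<^esub>s\<in>?B. (r \<otimes> f s) \<odot>\<^bsub>M\<^esub> \<phi> s)"
    using F.smult_closed[OF r f] supp r by (subst free_lift_superset[where B = ?B, OF _ \<phi>]) auto
  also have "\<dots> = (\<Oplus>\<^bsub>M\<^esub>s\<in>?B. r \<odot>\<^bsub>M\<^esub> (f s \<odot>\<^bsub>M\<^esub> \<phi> s))"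
    using \<phi> supp r by (intro M.finsum_cong') (auto simp: Pi_def smult_assoc1)
  also have "\<dots> = r \<odot>\<^bsub>M\<^esub> free_lift R M \<phi> f"
    unfolding free_lift_def using \<phi> supp r
    by (intro finsum_smult_ldistr[symmetric]) (auto simp: Pi_def)
  finally show "free_lift R M \<phi> (r \<odot>\<^bsub>free_module R S\<^esub> f) = r \<odot>\<^bsub>M\<^esub> free_lift R M \<phi> f" .
qed

lemma free_lift_basis:
  assumes "\<phi> s \<in> carrier M"
  shows "free_lift R M \<phi> (free_basis R s) = \<phi> s"
proof -
  have "free_lift R M \<phi> (free_basis R s) = (\<Oplus>\<^bsub>M\<^esub>t\<in>{s}. free_basis R s t \<odot>\<^bsub>M\<^esub> \<phi> t)"
  proof (rule free_lift_superset[where S = "{s}"])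
    show "free_basis R s \<in> carrier (free_module R {s})" by simp
  qed (use assms in \<open>auto simp: free_basis_def\<close>)
  then show ?thesis using assms by (simp add: free_basis_def)
qed

lemma linear_map_zero:
  assumes "linear_map R V M f" "module R V"
  shows "f \<zero>\<^bsub>V\<^esub> = \<zero>\<^bsub>M\<^esub>"
proof -
  interpret V: module R V by fact
  show ?thesis
    using linear_mapD(3)[OF assms(1), of "\<zero>" "\<zero>\<^bsub>V\<^esub>"] linear_mapD(1)[OF assms(1), of "\<zero>\<^bsub>V\<^esub>"]
    by simp
qed

lemma free_module_linear_ext:
  assumes "linear_map R (free_module R S) M f" and "linear_map R (free_module R S) M g"
    and "\<And>s. s \<in> S \<Longrightarrow> f (free_basis R s) = g (free_basis R s)"
    and x: "x \<in> carrier (free_module R S)"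
  shows "f x = g x"
  using x
proof (induction rule: R.free_module_induct)
  case zero
  then show ?case
    using linear_map_zero[OF assms(1) R.free_module_module]
      linear_map_zero[OF assms(2) R.free_module_module] by simp
next
  case (smult_basis r s)
  then show ?case
    using assms(3) linear_mapD(3)[OF assms(1)] linear_mapD(3)[OF assms(2)] by fastforce
next
  case (add u v)
  then show ?case
    using linear_mapD(2)[OF assms(1)] linear_mapD(2)[OF assms(2)] by fastforce
qed

lemma linear_map_add:
  assumes "linear_map R V M f" and "linear_map R V M g"
  shows "linear_map R V M (\<lambda>v. f v \<oplus>\<^bsub>M\<^esub> g v)"
  using assms by (auto simp: linear_map_def smult_r_distr M.add.m_ac)

lemma linear_map_smult:
  assumes "linear_map R V M f" and "r \<in> carrier R"
  shows "linear_map R V M (\<lambda>v. r \<odot>\<^bsub>M\<^esub> f v)"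
  using assms by (auto simp: linear_map_def smult_r_distr smult_assoc1[symmetric] R.m_comm)

lemma linear_map_free_lift_param:
  assumes "u \<in> carrier (free_module R S)" and "module R V"
    and \<phi>: "\<And>s. s \<in> S \<Longrightarrow> linear_map R V M (\<lambda>v. \<phi> v s)"
  shows "linear_map R V M (\<lambda>v. free_lift R M (\<phi> v) u)"
proof -
  interpret V: module R V by fact
  have c: "\<phi> v \<in> S \<rightarrow> carrier M" if "v \<in> carrier V" for v
    using linear_mapD(1)[OF \<phi>] that by auto
  show ?thesis
  proof (rule linear_mapI)
    fix v assume v: "v \<in> carrier V"
    show "free_lift R M (\<phi> v) u \<in> carrier M"
      using linear_mapD(1)[OF free_lift_linear[OF c[OF v]] assms(1)] .
    fix w assume w: "w \<in> carrier V"
    show "free_lift R M (\<phi> (v \<oplus>\<^bsub>V\<^esub> w)) u = free_lift R M (\<phi> v) u \<oplus>\<^bsub>M\<^esub> free_lift R M (\<phi> w) u"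
      by (rule free_module_linear_ext[where S = S])
        (use v w in \<open>auto intro!: linear_map_add free_lift_linear c assms(1)
          simp: free_lift_basis linear_mapD[OF \<phi>]\<close>)
  next
    fix r v assume r: "r \<in> carrier R" and v: "v \<in> carrier V"
    show "free_lift R M (\<phi> (r \<odot>\<^bsub>V\<^esub> v)) u = r \<odot>\<^bsub>M\<^esub> free_lift R M (\<phi> v) u"
      by (rule free_module_linear_ext[where S = S])
        (use v r in \<open>auto intro!: linear_map_smult free_lift_linear c assms(1)
          simp: free_lift_basis linear_mapD[OF \<phi>]\<close>)
  qed
qed

end

text \<open>Pointwise unfolding would hide the module operations from the module lemmas used below.\<close>

declare free_module_simps [simp del]

section \<open>Tensor products\<close>

locale tensor = V: module K V + W: module K W
  for K :: "('k, 'x) ring_scheme" and V :: "('k, 'v, 'y) module_scheme"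
    and W :: "('k, 'w, 'z) module_scheme"
begin

abbreviation "F \<equiv> free_module K (carrier V \<times> carrier W)"
abbreviation "N \<equiv> tensor_relations K V W"
abbreviation "T \<equiv> tensor_product K V W"
abbreviation "pure \<equiv> pure_tensor K V W"

sublocale F: module K F
  by (rule V.R.free_module_module)

lemma tensor_generators_subset: "tensor_generators K V W \<subseteq> carrier F"
  unfolding tensor_generators_def Let_def
  by (auto intro!: F.minus_closed F.a_closed F.smult_closed)

lemma tensor_relations_submodule: "submodule N K F"
proof (rule F.submoduleI)
  have sub: "submodule H K F" if "H \<in> {H. submodule H K F \<and> tensor_generators K V W \<subseteq> H}" for H
    using that by simp
  show "N \<subseteq> carrier F"
    using F.carrier_is_submodule tensor_generators_subset by (auto simp: tensor_relations_def)
  show "\<zero>\<^bsub>F\<^esub> \<in> N"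
    using subgroup.one_closed[OF submodule.axioms(1)] by (fastforce simp: tensor_relations_def)
qed (auto simp: tensor_relations_def dest: F.submoduleE)

lemma tensor_generators_relations: "x \<in> tensor_generators K V W \<Longrightarrow> x \<in> N"
  by (auto simp: tensor_relations_def)

sublocale N: abelian_subgroup N F
  by (rule abelian_subgroupI3)
    (simp_all add: additive_subgroup_def submodule.axioms(1)[OF tensor_relations_submodule]
      F.abelian_group_axioms)

abbreviation cls where "cls f \<equiv> N +>\<^bsub>F\<^esub> f"

lemma cls_eq_iff:
  assumes "f \<in> carrier F" "g \<in> carrier F"
  shows "cls f = cls g \<longleftrightarrow> f \<ominus>\<^bsub>F\<^esub> g \<in> N"
proof -
  have "f \<ominus>\<^bsub>F\<^esub> g \<in> N \<longleftrightarrow> f \<in> cls g"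
    using N.a_rcos_module assms by (simp add: a_minus_def)
  then show ?thesis
    using assms N.a_repr_independence' N.a_repr_independenceD N.a_rcos_self by metis
qed

lemma tensor_product_carrier: "carrier T = cls ` carrier F"
  by (auto simp: tensor_product_def Let_def A_RCOSETS_def')

lemma tensor_product_zero: "\<zero>\<^bsub>T\<^esub> = cls \<zero>\<^bsub>F\<^esub>"
  by (simp add: tensor_product_def Let_def F.a_coset_add_zero N.a_subset)

lemma tensor_product_add:
  assumes "f \<in> carrier F" "g \<in> carrier F"
  shows "cls f \<oplus>\<^bsub>T\<^esub> cls g = cls (f \<oplus>\<^bsub>F\<^esub> g)"
  using assms by (simp add: tensor_product_def Let_def N.a_rcos_sum)

lemma tensor_product_smult:
  assumes r: "r \<in> carrier K" and f: "f \<in> carrier F"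
  shows "r \<odot>\<^bsub>T\<^esub> cls f = cls (r \<odot>\<^bsub>F\<^esub> f)"
proof -
  have "cls (r \<odot>\<^bsub>F\<^esub> g) = cls (r \<odot>\<^bsub>F\<^esub> f)" if g: "g \<in> cls f" for g
  proof -
    have gc: "g \<in> carrier F"
      using g f by (rule N.a_elemrcos_carrier[rotated])
    have "g \<ominus>\<^bsub>F\<^esub> f \<in> N"
      using cls_eq_iff[OF gc f] N.a_repr_independence'[OF g f] by simp
    then have "r \<odot>\<^bsub>F\<^esub> (g \<ominus>\<^bsub>F\<^esub> f) \<in> N"
      by (rule submodule.smult_closed[OF tensor_relations_submodule r])
    then have "r \<odot>\<^bsub>F\<^esub> g \<ominus>\<^bsub>F\<^esub> r \<odot>\<^bsub>F\<^esub> f \<in> N"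
      using r gc f by (simp add: a_minus_def F.smult_r_distr F.smult_r_minus)
    then show ?thesis
      using cls_eq_iff r gc f by (simp)
  qed
  moreover have "f \<in> cls f" by (rule N.a_rcos_self[OF f])
  ultimately have "(\<Union>g\<in>cls f. cls (r \<odot>\<^bsub>F\<^esub> g)) = cls (r \<odot>\<^bsub>F\<^esub> f)" by blast
  then show ?thesis by (simp add: tensor_product_def Let_def)
qed

lemma tensor_product_module: "module K T"
proof -
  note * = tensor_product_carrier tensor_product_zero tensor_product_add tensor_product_smult
  have inv: "\<exists>Y\<in>carrier T. Y \<oplus>\<^bsub>T\<^esub> X = \<zero>\<^bsub>T\<^esub>" if "X \<in> carrier T" for X
  proof -
    from that obtain f where "f \<in> carrier F" "X = cls f" by (auto simp: *)
    then show ?thesis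
      by (intro bexI[of _ "cls (\<ominus>\<^bsub>F\<^esub> f)"]) (auto simp: * F.l_neg)
  qed
  show ?thesis
    by (intro moduleI abelian_groupI inv)
      (auto simp: * F.M.add.m_ac F.smult_l_distr F.smult_r_distr F.smult_assoc1 V.R.is_cring
       )
qed

sublocale T: module K T
  by (rule tensor_product_module)

lemma pure_tensor_bilinear: "bilinear_map K V W T pure"
proof -
  note * = tensor_product_add tensor_product_smult
  have b: "free_basis K (v, w) \<in> carrier F" if "v \<in> carrier V" "w \<in> carrier W" for v w
    using that by simp
  have e: "cls f = cls g" if "f \<ominus>\<^bsub>F\<^esub> g \<in> tensor_generators K V W" "f \<in> carrier F" "g \<in> carrier F" for f g
    using that cls_eq_iff tensor_generators_relations by blast
  show ?thesis
    unfolding bilinear_map_def linear_map_def pure_tensor_def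
    apply (intro conjI ballI)
    subgoal using b by (auto simp: tensor_product_carrier)
    subgoal for v w w' by (subst *(1), simp, simp, rule e)
       (auto simp: tensor_generators_def Let_def)
    subgoal for v r w by (subst *(2), simp, simp, rule e)
       (auto simp: tensor_generators_def Let_def)
    subgoal using b by (auto simp: tensor_product_carrier)
    subgoal for w v v' by (subst *(1), simp, simp, rule e)
       (auto simp: tensor_generators_def Let_def)
    subgoal for w r v by (subst *(2), simp, simp, rule e)
       (auto simp: tensor_generators_def Let_def)
    done
qed

lemma pure_simps:
  assumes "v \<in> carrier V" "w \<in> carrier W"
  shows "pure v w \<in> carrier T"
    and "v' \<in> carrier V \<Longrightarrow> pure (v \<oplus>\<^bsub>V\<^esub> v') w = pure v w \<oplus>\<^bsub>T\<^esub> pure v' w"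
    and "w' \<in> carrier W \<Longrightarrow> pure v (w \<oplus>\<^bsub>W\<^esub> w') = pure v w \<oplus>\<^bsub>T\<^esub> pure v w'"
    and "r \<in> carrier K \<Longrightarrow> pure (r \<odot>\<^bsub>V\<^esub> v) w = r \<odot>\<^bsub>T\<^esub> pure v w"
    and "r \<in> carrier K \<Longrightarrow> pure v (r \<odot>\<^bsub>W\<^esub> w) = r \<odot>\<^bsub>T\<^esub> pure v w"
  using pure_tensor_bilinear assms unfolding bilinear_map_def linear_map_def by blast+

lemma tensor_induct [consumes 1, case_names pure add]:
  assumes "X \<in> carrier T"
    and pure: "\<And>v w. v \<in> carrier V \<Longrightarrow> w \<in> carrier W \<Longrightarrow> P (pure v w)"
    and add: "\<And>X Y. X \<in> carrier T \<Longrightarrow> Y \<in> carrier T \<Longrightarrow> P X \<Longrightarrow> P Y \<Longrightarrow> P (X \<oplus>\<^bsub>T\<^esub> Y)"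
  shows "P X"
proof -
  have "P (cls f)" if "f \<in> carrier F" for f
    using that
  proof (induction rule: V.R.free_module_induct)
    case zero
    have "pure \<zero>\<^bsub>V\<^esub> \<zero>\<^bsub>W\<^esub> = pure (\<zero>\<^bsub>K\<^esub> \<odot>\<^bsub>V\<^esub> \<zero>\<^bsub>V\<^esub>) \<zero>\<^bsub>W\<^esub>" by simp
    also have "\<dots> = \<zero>\<^bsub>T\<^esub>" by (subst pure_simps) (auto simp: pure_simps)
    finally show ?case
      using pure[of "\<zero>\<^bsub>V\<^esub>" "\<zero>\<^bsub>W\<^esub>"] by (simp add: tensor_product_zero free_module_simps)
  next
    case (smult_basis r s)
    then obtain v w where s: "s = (v, w)" "v \<in> carrier V" "w \<in> carrier W" by auto
    then have "cls (r \<odot>\<^bsub>F\<^esub> free_basis K s) = r \<odot>\<^bsub>T\<^esub> pure v w"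
      using smult_basis by (simp add: tensor_product_smult pure_tensor_def)
    then show ?case
      using pure[of "r \<odot>\<^bsub>V\<^esub> v" w] s smult_basis by (simp add: pure_simps)
  next
    case (add f g)
    then show ?case
      using assms(3)[of "cls f" "cls g"] tensor_product_add[of f g]
      by (simp add: tensor_product_carrier)
  qed
  then show ?thesis using assms(1) by (auto simp: tensor_product_carrier)
qed

lemma tensor_lift_cls:
  assumes "module K U" and \<phi>: "bilinear_map K V W U \<phi>" and f: "f \<in> carrier F"
  shows "tensor_lift K U \<phi> (cls f) = free_lift K U (\<lambda>(v, w). \<phi> v w) f"
proof -
  interpret U: module K U by fact
  let ?L = "free_lift K U (\<lambda>(v, w). \<phi> v w)"
  have c: "(\<lambda>(v, w). \<phi> v w) \<in> carrier V \<times> carrier W \<rightarrow> carrier U"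
    using \<phi> by (auto simp: bilinear_map_def linear_map_def)
  have L: "linear_map K F U ?L" by (rule U.free_lift_linear[OF c])
  have Lb: "?L (free_basis K (v, w)) = \<phi> v w" if "v \<in> carrier V" "w \<in> carrier W" for v w
    using that \<phi> by (subst U.free_lift_basis) (auto simp: bilinear_map_def linear_map_def)
  have m: "?L (x \<ominus>\<^bsub>F\<^esub> y) = ?L x \<ominus>\<^bsub>U\<^esub> ?L y" if "x \<in> carrier F" "y \<in> carrier F" for x y
  proof -
    have "?L ((x \<ominus>\<^bsub>F\<^esub> y) \<oplus>\<^bsub>F\<^esub> y) = ?L (x \<ominus>\<^bsub>F\<^esub> y) \<oplus>\<^bsub>U\<^esub> ?L y"
      using that by (intro linear_mapD(2)[OF L]) (auto)
    moreover have "(x \<ominus>\<^bsub>F\<^esub> y) \<oplus>\<^bsub>F\<^esub> y = x"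
      using that by (simp add: a_minus_def F.M.a_assoc F.l_neg)
    ultimately show ?thesis
      using that linear_mapD(1)[OF L] F.minus_closed[OF that]
      by (metis U.M.add.inv_solve_right a_minus_def)
  qed
  have self: "u \<ominus>\<^bsub>U\<^esub> u = \<zero>\<^bsub>U\<^esub>" if "u \<in> carrier U" for u
    using that by (simp add: a_minus_def U.M.r_neg)
  let ?k = "{x \<in> carrier F. ?L x = \<zero>\<^bsub>U\<^esub>}"
  have "tensor_generators K V W \<subseteq> ?k"
  proof -
    have "?L x = \<zero>\<^bsub>U\<^esub>" if "x \<in> tensor_generators K V W" for x
      using that \<phi> unfolding tensor_generators_def Let_def
      by (auto simp: self m linear_mapD[OF L] Lb bilinear_map_def linear_map_def 
         )
    then show ?thesis using tensor_generators_subset by blast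
  qed
  then have "N \<subseteq> ?k"
    using linear_map_submodule_kernel[OF F.module_axioms assms(1) L]
    by (auto simp: tensor_relations_def)
  define g where "g = (SOME g. g \<in> cls f)"
  have "g \<in> cls f"
    unfolding g_def by (rule someI[of _ f]) (rule N.a_rcos_self[OF f])
  then have g: "g \<in> carrier F" "cls g = cls f"
    using f N.a_elemrcos_carrier N.a_repr_independence' by auto
  then have "?L (g \<ominus>\<^bsub>F\<^esub> f) = \<zero>\<^bsub>U\<^esub>"
    using cls_eq_iff f \<open>N \<subseteq> ?k\<close> by blast
  then have "?L g = ?L f"
    using m[OF g(1) f] linear_mapD(1)[OF L g(1)] linear_mapD(1)[OF L f]
    by (metis U.M.add.inv_solve_right U.M.l_zero U.M.zero_closed a_minus_def)
  then show ?thesis by (simp add: tensor_lift_def g_def)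
qed

lemma tensor_lift_linear:
  assumes "module K U" and \<phi>: "bilinear_map K V W U \<phi>"
  shows "linear_map K T U (tensor_lift K U \<phi>)"
proof -
  interpret U: module K U by fact
  have L: "linear_map K F U (free_lift K U (\<lambda>(v, w). \<phi> v w))"
    using \<phi> by (intro U.free_lift_linear) (auto simp: bilinear_map_def linear_map_def)
  show ?thesis
    by (rule linear_mapI)
      (auto simp: tensor_product_carrier tensor_product_add tensor_product_smult
        tensor_lift_cls[OF assms] linear_mapD[OF L])
qed

lemma tensor_lift_pure:
  assumes "module K U" and \<phi>: "bilinear_map K V W U \<phi>" and "v \<in> carrier V" "w \<in> carrier W"
  shows "tensor_lift K U \<phi> (pure v w) = \<phi> v w"
proof -
  interpret U: module K U by fact
  show ?thesis
    unfolding pure_tensor_def using assms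
    by (subst tensor_lift_cls) (auto simp: U.free_lift_basis bilinear_map_def linear_map_def)
qed

lemma tensor_linear_ext:
  assumes "linear_map K T U f" and "linear_map K T U g"
    and "\<And>v w. v \<in> carrier V \<Longrightarrow> w \<in> carrier W \<Longrightarrow> f (pure v w) = g (pure v w)"
    and "X \<in> carrier T"
  shows "f X = g X"
  using assms(4)
proof (induction rule: tensor_induct)
  case (add X Y)
  then show ?case
    using linear_mapD(2)[OF assms(1)] linear_mapD(2)[OF assms(2)] by simp
qed (rule assms(3))

lemma linear_map_tensor_lift_param:
  assumes "X \<in> carrier T" and "module K S" and "module K U"
    and bil: "\<And>s. s \<in> carrier S \<Longrightarrow> bilinear_map K V W U (\<phi> s)"
    and lin: "\<And>v w. v \<in> carrier V \<Longrightarrow> w \<in> carrier W \<Longrightarrow> linear_map K S U (\<lambda>s. \<phi> s v w)"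
  shows "linear_map K S U (\<lambda>s. tensor_lift K U (\<phi> s) X)"
proof -
  interpret S: module K S by fact
  interpret U: module K U by fact
  note L = tensor_lift_linear[OF assms(3) bil] and P = tensor_lift_pure[OF assms(3) bil]
  show ?thesis
  proof (rule linear_mapI)
    fix s assume s: "s \<in> carrier S"
    show "tensor_lift K U (\<phi> s) X \<in> carrier U"
      by (rule linear_mapD(1)[OF L[OF s] assms(1)])
    fix t assume t: "t \<in> carrier S"
    show "tensor_lift K U (\<phi> (s \<oplus>\<^bsub>S\<^esub> t)) X = tensor_lift K U (\<phi> s) X \<oplus>\<^bsub>U\<^esub> tensor_lift K U (\<phi> t) X"
      by (rule tensor_linear_ext)
        (use s t in \<open>auto intro!: L U.linear_map_add assms(1) simp: P linear_mapD[OF lin]\<close>)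
  next
    fix r s assume r: "r \<in> carrier K" and s: "s \<in> carrier S"
    show "tensor_lift K U (\<phi> (r \<odot>\<^bsub>S\<^esub> s)) X = r \<odot>\<^bsub>U\<^esub> tensor_lift K U (\<phi> s) X"
      by (rule tensor_linear_ext)
        (use r s in \<open>auto intro!: L U.linear_map_smult assms(1) simp: P linear_mapD[OF lin]\<close>)
  qed
qed

end

section \<open>Additive generators of a ring\<close>

definition additive_generators :: "('a, 'x) ring_scheme \<Rightarrow> 'a set \<Rightarrow> bool" where
  "additive_generators R B \<longleftrightarrow> B \<subseteq> carrier R \<and>
    (\<forall>H. B \<subseteq> H \<longrightarrow> (\<forall>x\<in>carrier R \<inter> H. \<forall>y\<in>carrier R \<inter> H. x \<oplus>\<^bsub>R\<^esub> y \<in> H) \<longrightarrow> carrier R \<subseteq> H)"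

lemma additive_generators_induct [consumes 2, case_names generator add]:
  assumes "additive_generators R B" and "x \<in> carrier R"
    and "\<And>b. b \<in> B \<Longrightarrow> P b"
    and "\<And>x y. x \<in> carrier R \<Longrightarrow> y \<in> carrier R \<Longrightarrow> P x \<Longrightarrow> P y \<Longrightarrow> P (x \<oplus>\<^bsub>R\<^esub> y)"
  shows "P x"
proof -
  have "carrier R \<subseteq> Collect P"
    using assms(1) unfolding additive_generators_def
    by (elim conjE allE[of _ "Collect P"] impE) (use assms in auto)
  then show ?thesis using assms(2) by auto
qed

lemma (in tensor) pure_additive_generators:
  "additive_generators T {pure v w | v w. v \<in> carrier V \<and> w \<in> carrier W}"
  unfolding additive_generators_def
proof (intro conjI allI impI subsetI, goal_cases)
  case (2 H X)
  from 2(3) show ?case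
    by (induction rule: tensor_induct) (use 2(1,2) in blast)+
qed (auto simp: pure_simps)

lemma ring_of_generators:
  fixes R (structure)
  assumes "abelian_group R" and gen: "additive_generators R B"
    and closed: "\<And>x y. x \<in> carrier R \<Longrightarrow> y \<in> carrier R \<Longrightarrow> x \<otimes> y \<in> carrier R"
    and l: "\<And>x y z. x \<in> carrier R \<Longrightarrow> y \<in> carrier R \<Longrightarrow> z \<in> carrier R \<Longrightarrow>
      (x \<oplus> y) \<otimes> z = x \<otimes> z \<oplus> y \<otimes> z"
    and r: "\<And>x y z. x \<in> carrier R \<Longrightarrow> y \<in> carrier R \<Longrightarrow> z \<in> carrier R \<Longrightarrow>
      z \<otimes> (x \<oplus> y) = z \<otimes> x \<oplus> z \<otimes> y"
    and one: "\<one> \<in> carrier R"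
    and l_one: "\<And>b. b \<in> B \<Longrightarrow> \<one> \<otimes> b = b" and r_one: "\<And>b. b \<in> B \<Longrightarrow> b \<otimes> \<one> = b"
    and assoc: "\<And>b c d. b \<in> B \<Longrightarrow> c \<in> B \<Longrightarrow> d \<in> B \<Longrightarrow> b \<otimes> c \<otimes> d = b \<otimes> (c \<otimes> d)"
  shows "ring R"
proof -
  have B: "b \<in> carrier R" if "b \<in> B" for b
    using gen that by (auto simp: additive_generators_def)
  have a1: "b \<otimes> c \<otimes> z = b \<otimes> (c \<otimes> z)" if "z \<in> carrier R" "b \<in> B" "c \<in> B" for b c z
    using gen that
    by (induction rule: additive_generators_induct) (simp_all add: assoc r closed B)
  have a2: "b \<otimes> y \<otimes> z = b \<otimes> (y \<otimes> z)" if "y \<in> carrier R" "b \<in> B" "z \<in> carrier R" for b y z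
    using gen that
    by (induction rule: additive_generators_induct) (simp_all add: a1 l r closed B)
  have a3: "x \<otimes> y \<otimes> z = x \<otimes> (y \<otimes> z)"
    if "x \<in> carrier R" "y \<in> carrier R" "z \<in> carrier R" for x y z
    using gen that
    by (induction rule: additive_generators_induct) (simp_all add: a2 l r closed B)
  have o1: "\<one> \<otimes> x = x" if "x \<in> carrier R" for x
    using gen that by (induction rule: additive_generators_induct) (simp_all add: l_one r one)
  have o2: "x \<otimes> \<one> = x" if "x \<in> carrier R" for x
    using gen that by (induction rule: additive_generators_induct) (simp_all add: r_one l one)
  show ?thesis
    by (intro ringI assms(1) monoidI) (auto simp: a3 o1 o2 l r closed one)
qed

lemma abelian_group_cong:
  assumes "abelian_group G" and c: "carrier H = carrier G" "zero H = zero G" "add H = add G"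
  shows "abelian_group H"
proof -
  interpret G: abelian_group G by fact
  have "\<exists>y\<in>carrier G. y \<oplus>\<^bsub>G\<^esub> x = \<zero>\<^bsub>G\<^esub>" if "x \<in> carrier G" for x
    using that by (intro bexI[of _ "\<ominus>\<^bsub>G\<^esub> x"]) (auto simp: G.l_neg)
  then show ?thesis
    by (intro abelian_groupI) (auto simp: c G.add.m_ac)
qed

lemma module_cong:
  assumes "module K M"
    and c: "carrier N = carrier M" "zero N = zero M" "add N = add M" "smult N = smult M"
  shows "module K N"
proof -
  interpret M: module K M by fact
  show ?thesis
    by (intro moduleI abelian_group_cong[OF M.M.abelian_group_axioms])
      (auto simp: c M.smult_l_distr M.smult_r_distr M.smult_assoc1 M.R.is_cring)
qed

context tensor
begin

lemmas pure_linear = bilinear_mapD[OF pure_tensor_bilinear]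

lemma tensor_product_bilinear_extension:
  assumes \<mu>1: "\<And>v w. v \<in> carrier V \<Longrightarrow> w \<in> carrier W \<Longrightarrow> bilinear_map K V W T (\<mu> v w)"
    and \<mu>2: "\<And>v w. v \<in> carrier V \<Longrightarrow> w \<in> carrier W \<Longrightarrow> bilinear_map K V W T (\<lambda>v' w'. \<mu> v' w' v w)"
  defines "p X Y \<equiv> tensor_lift K T (\<lambda>v w. tensor_lift K T (\<mu> v w) Y) X"
  shows "bilinear_map K T T T p"
    and "\<lbrakk>v \<in> carrier V; w \<in> carrier W; v' \<in> carrier V; w' \<in> carrier W\<rbrakk> \<Longrightarrow>
      p (pure v w) (pure v' w') = \<mu> v w v' w'"
proof -
  have inner: "bilinear_map K V W T (\<lambda>v w. tensor_lift K T (\<mu> v w) Y)" if Y: "Y \<in> carrier T" for Y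
  proof (rule bilinear_mapI)
    fix v assume "v \<in> carrier V"
    then show "linear_map K W T (\<lambda>w. tensor_lift K T (\<mu> v w) Y)"
      using \<mu>1 bilinear_mapD(1)[OF \<mu>2] by (intro linear_map_tensor_lift_param Y) unfold_locales
  next
    fix w assume "w \<in> carrier W"
    then show "linear_map K V T (\<lambda>v. tensor_lift K T (\<mu> v w) Y)"
      using \<mu>1 bilinear_mapD(2)[OF \<mu>2] by (intro linear_map_tensor_lift_param Y) unfold_locales
  qed
  show "bilinear_map K T T T p"
    unfolding p_def
  proof (rule bilinear_mapI)
    fix X assume X: "X \<in> carrier T"
    show "linear_map K T T (\<lambda>Y. tensor_lift K T (\<lambda>v w. tensor_lift K T (\<mu> v w) Y) X)"
      using inner \<mu>1
      by (intro linear_map_tensor_lift_param X tensor_product_module tensor_lift_linear) simp_all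
  next
    fix Y assume "Y \<in> carrier T"
    then show "linear_map K T T (\<lambda>X. tensor_lift K T (\<lambda>v w. tensor_lift K T (\<mu> v w) Y) X)"
      using inner by (intro tensor_lift_linear tensor_product_module) simp
  qed
  assume *: "v \<in> carrier V" "w \<in> carrier W" "v' \<in> carrier V" "w' \<in> carrier W"
  then show "p (pure v w) (pure v' w') = \<mu> v w v' w'"
    using inner \<mu>1
    by (simp add: p_def tensor_lift_pure[OF tensor_product_module] pure_simps)
qed

end

section \<open>Tensor products of algebras\<close>

lemma (in assoc_algebra) opposite_simps [simp]:
  "carrier (opposite A) = carrier A" "zero (opposite A) = zero A" "add (opposite A) = add A"
  "smult (opposite A) = smult A" "one (opposite A) = one A"
  "x \<otimes>\<^bsub>opposite A\<^esub> y = y \<otimes>\<^bsub>A\<^esub> x"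
  by (simp_all add: opposite_def)

lemma (in assoc_algebra) opposite_assoc_algebra: "assoc_algebra K (opposite A)"
proof -
  have "module K (opposite A)"
    by (rule module_cong[OF module_axioms]) simp_all
  moreover have "ring (opposite A)"
    using abelian_group.axioms
    by (intro ringI monoidI module.axioms(2)[OF calculation])
      (auto simp: A.m_assoc A.l_distr A.r_distr)
  ultimately show ?thesis
    by (auto intro!: assoc_algebra.intro assoc_algebra_axioms.intro
        simp: smult_mult_left smult_mult_right)
qed

lemma (in assoc_algebra) mult_bilinear: "bilinear_map K A A A (\<lambda>a b. a \<otimes>\<^bsub>A\<^esub> b)"
  by (intro bilinear_mapI linear_mapI)
    (auto simp: A.l_distr A.r_distr smult_mult_left smult_mult_right)

locale algebra_pair = A: assoc_algebra K A + B: assoc_algebra K B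
  for K :: "('k, 'x) ring_scheme" and A :: "('k, 'a, 'y) module_scheme"
    and B :: "('k, 'b, 'z) module_scheme"
begin

sublocale tensor K A B ..

abbreviation "AB \<equiv> algebra_tensor K A B"

lemma algebra_tensor_simps [simp]:
  "carrier AB = carrier T" "zero AB = zero T" "add AB = add T" "smult AB = smult T"
  "one AB = pure \<one>\<^bsub>A\<^esub> \<one>\<^bsub>B\<^esub>"
  by (simp_all add: algebra_tensor_def Let_def)

lemma pure_mult_bilinear:
  shows "a \<in> carrier A \<Longrightarrow> b \<in> carrier B \<Longrightarrow>
      bilinear_map K A B T (\<lambda>a' b'. pure (a \<otimes>\<^bsub>A\<^esub> a') (b \<otimes>\<^bsub>B\<^esub> b'))"
    and "a \<in> carrier A \<Longrightarrow> b \<in> carrier B \<Longrightarrow>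
      bilinear_map K A B T (\<lambda>a' b'. pure (a' \<otimes>\<^bsub>A\<^esub> a) (b' \<otimes>\<^bsub>B\<^esub> b))"
  by (auto intro!: bilinear_mapI linear_map_comp[OF _ pure_linear(1)] linear_map_comp[OF _ pure_linear(2)]
      bilinear_mapD[OF A.mult_bilinear] bilinear_mapD[OF B.mult_bilinear])

lemma algebra_tensor_mult:
  shows "bilinear_map K T T T (\<lambda>X Y. X \<otimes>\<^bsub>AB\<^esub> Y)"
    and "\<lbrakk>a \<in> carrier A; b \<in> carrier B; a' \<in> carrier A; b' \<in> carrier B\<rbrakk> \<Longrightarrow>
      pure a b \<otimes>\<^bsub>AB\<^esub> pure a' b' = pure (a \<otimes>\<^bsub>A\<^esub> a') (b \<otimes>\<^bsub>B\<^esub> b')"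
  using tensor_product_bilinear_extension[where \<mu> = "\<lambda>a b a' b'. pure (a \<otimes>\<^bsub>A\<^esub> a') (b \<otimes>\<^bsub>B\<^esub> b')"]
    pure_mult_bilinear
  by (simp_all add: algebra_tensor_def Let_def)

lemma algebra_tensor_assoc_algebra: "assoc_algebra K AB"
proof -
  have m: "module K AB"
    by (rule module_cong[OF tensor_product_module]) simp_all
  note lin = linear_mapD[OF bilinear_mapD(1)[OF algebra_tensor_mult(1)]]
    linear_mapD[OF bilinear_mapD(2)[OF algebra_tensor_mult(1)]]
  have "additive_generators AB {pure v w | v w. v \<in> carrier A \<and> w \<in> carrier B}"
    using pure_additive_generators by (simp add: additive_generators_def)
  then have "ring AB"
    by (rule ring_of_generators[OF module.axioms(2)[OF m]])
      (auto simp: lin pure_simps algebra_tensor_mult(2) A.m_assoc B.m_assoc)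
  with m show ?thesis
    by (auto intro!: assoc_algebra.intro assoc_algebra_axioms.intro simp: lin)
qed

end

lemma mem_carrier_Z2 [simp]: "i \<in> carrier Z2 \<longleftrightarrow> i = 0 \<or> i = 1"
  by (auto simp: carrier_integer_mod_group)

section \<open>The involutive enveloping algebra is a ring\<close>

context involutive_algebra
begin

sublocale E: algebra_pair K A "opposite A"
  by (simp add: algebra_pair_def assoc_algebra_axioms opposite_assoc_algebra)

abbreviation "Env \<equiv> enveloping_algebra K A"
abbreviation "\<tau> \<equiv> envelope_flip K A"

lemma Env_eq: "Env = E.AB"
  by (simp add: enveloping_algebra_def)

lemma star_one: "star A \<one>\<^bsub>A\<^esub> = \<one>\<^bsub>A\<^esub>"
proof -
  have "star A (star A \<one>\<^bsub>A\<^esub> \<otimes>\<^bsub>A\<^esub> \<one>\<^bsub>A\<^esub>) = star A \<one>\<^bsub>A\<^esub> \<otimes>\<^bsub>A\<^esub> \<one>\<^bsub>A\<^esub>"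
    by (simp add: star_mult star_closed star_star del: A.r_one)
  then show ?thesis by (simp add: star_closed star_star)
qed

lemma bilinear_opposite: "bilinear_map K A (opposite A) U \<phi> \<longleftrightarrow> bilinear_map K A A U \<phi>"
  by (simp add: bilinear_map_def linear_map_def)

lemma Env_linear: "linear_map K Env U f \<longleftrightarrow> linear_map K E.T U f"
  by (simp add: linear_map_def Env_eq)

lemma Env_assoc_algebra: "assoc_algebra K Env"
  unfolding Env_eq by (rule E.algebra_tensor_assoc_algebra)

sublocale Env: assoc_algebra K Env
  by (rule Env_assoc_algebra)

lemma Env_pure_closed [simp]:
  "a \<in> carrier A \<Longrightarrow> b \<in> carrier A \<Longrightarrow> E.pure a b \<in> carrier Env"
  by (simp add: Env_eq E.pure_simps)

lemma Env_pure_add: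
  assumes "a \<in> carrier A" "b \<in> carrier A" "c \<in> carrier A"
  shows "E.pure (a \<oplus>\<^bsub>A\<^esub> c) b = E.pure a b \<oplus>\<^bsub>Env\<^esub> E.pure c b"
    and "E.pure a (b \<oplus>\<^bsub>A\<^esub> c) = E.pure a b \<oplus>\<^bsub>Env\<^esub> E.pure a c"
  using assms E.pure_simps(2)[of a b c] E.pure_simps(3)[of a b c] by (simp_all add: Env_eq)

lemma Env_pure_smult:
  assumes "r \<in> carrier K" "a \<in> carrier A" "b \<in> carrier A"
  shows "E.pure (r \<odot>\<^bsub>A\<^esub> a) b = r \<odot>\<^bsub>Env\<^esub> E.pure a b"
    and "E.pure a (r \<odot>\<^bsub>A\<^esub> b) = r \<odot>\<^bsub>Env\<^esub> E.pure a b"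
  using assms E.pure_simps(4)[of a b r] E.pure_simps(5)[of a b r] by (simp_all add: Env_eq)

lemma Env_one: "\<one>\<^bsub>Env\<^esub> = E.pure \<one>\<^bsub>A\<^esub> \<one>\<^bsub>A\<^esub>"
  by (simp add: Env_eq)

lemma Env_mult:
  "\<lbrakk>a \<in> carrier A; b \<in> carrier A; c \<in> carrier A; d \<in> carrier A\<rbrakk> \<Longrightarrow>
    E.pure a b \<otimes>\<^bsub>Env\<^esub> E.pure c d = E.pure (a \<otimes>\<^bsub>A\<^esub> c) (d \<otimes>\<^bsub>A\<^esub> b)"
  by (simp add: Env_eq E.algebra_tensor_mult)

lemma Env_induct [consumes 1, case_names pure add]:
  assumes "x \<in> carrier Env"
    and "\<And>a b. a \<in> carrier A \<Longrightarrow> b \<in> carrier A \<Longrightarrow> P (E.pure a b)"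
    and "\<And>x y. x \<in> carrier Env \<Longrightarrow> y \<in> carrier Env \<Longrightarrow> P x \<Longrightarrow> P y \<Longrightarrow> P (x \<oplus>\<^bsub>Env\<^esub> y)"
  shows "P x"
  using E.tensor_induct[of x P] assms by (simp add: Env_eq)

lemma flip_bilinear: "bilinear_map K A A Env (\<lambda>a b. E.pure (star A b) (star A a))"
  by (intro bilinear_mapI linear_mapI)
    (simp_all add: star_add star_smult star_closed Env_pure_add Env_pure_smult)

lemma flip_linear: "linear_map K Env Env \<tau>"
  unfolding envelope_flip_def Env_linear
  by (rule E.tensor_lift_linear) (simp_all add: bilinear_opposite flip_bilinear Env.module_axioms)

lemma flip_pure:
  "a \<in> carrier A \<Longrightarrow> b \<in> carrier A \<Longrightarrow> \<tau> (E.pure a b) = E.pure (star A b) (star A a)"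
  unfolding envelope_flip_def
  by (subst E.tensor_lift_pure) (simp_all add: bilinear_opposite flip_bilinear Env.module_axioms)

lemmas flip_simps = linear_mapD[OF flip_linear]

lemma flip_flip: "x \<in> carrier Env \<Longrightarrow> \<tau> (\<tau> x) = x"
  by (induction rule: Env_induct) (simp_all add: flip_pure star_closed star_star flip_simps)

lemma flip_one: "\<tau> \<one>\<^bsub>Env\<^esub> = \<one>\<^bsub>Env\<^esub>"
  by (simp add: Env_one flip_pure star_one)

lemma flip_mult:
  assumes "x \<in> carrier Env" "y \<in> carrier Env"
  shows "\<tau> (x \<otimes>\<^bsub>Env\<^esub> y) = \<tau> x \<otimes>\<^bsub>Env\<^esub> \<tau> y"
  using assms
proof (induction rule: Env_induct)
  case (pure a b)
  from pure(3,1,2) show ?case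
    by (induction rule: Env_induct)
      (simp_all add: flip_pure Env_mult star_closed star_mult flip_simps Env.A.r_distr)
qed (simp add: flip_simps Env.A.l_distr)

lemma flip_power_linear: "linear_map K Env Env (\<tau> ^^ n)"
proof (induction n)
  case (Suc n)
  then show ?case using linear_map_comp[OF Suc flip_linear] by (simp add: comp_def)
qed (simp add: linear_map_def)

abbreviation "kZ2 \<equiv> free_module K (carrier Z2)"

sublocale I: tensor K Env kZ2
  by (simp add: tensor_def Env.module_axioms free_module_module)

abbreviation "IE \<equiv> involutive_enveloping_algebra K A"
abbreviation "elt x i \<equiv> I.pure x (free_basis K i)"

lemma IE_simps [simp]:
  "carrier IE = carrier I.T" "zero IE = zero I.T" "add IE = add I.T" "smult IE = smult I.T"
  "one IE = elt \<one>\<^bsub>Env\<^esub> 0"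
  by (simp_all add: involutive_enveloping_algebra_def Let_def)

lemma elt_additive_generators:
  "additive_generators IE {elt x i | x i. x \<in> carrier Env \<and> i \<in> carrier Z2}"
  unfolding additive_generators_def IE_simps
proof (intro conjI allI impI subsetI, goal_cases)
  case (2 H X)
  have B: "elt x i \<in> H" if "x \<in> carrier Env" "i \<in> carrier Z2" for x i
    using 2(1) that by blast
  have H: "I.pure x u \<in> H" if "x \<in> carrier Env" "u \<in> carrier kZ2" for x u
    using that(2,1)
  proof (induction arbitrary: x rule: free_module_induct)
    case zero
    have "I.pure x \<zero>\<^bsub>kZ2\<^esub> = elt \<zero>\<^bsub>Env\<^esub> 0"
    proof -
      have "I.pure x (\<zero> \<odot>\<^bsub>kZ2\<^esub> \<zero>\<^bsub>kZ2\<^esub>) = I.pure (\<zero> \<odot>\<^bsub>Env\<^esub> \<zero>\<^bsub>Env\<^esub>) (free_basis K 0)"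
        using zero I.pure_simps(5)[of x "\<zero>\<^bsub>kZ2\<^esub>" \<zero>]
          I.pure_simps(4)[of "\<zero>\<^bsub>Env\<^esub>" "free_basis K 0" \<zero>]
        by (simp add: I.pure_simps)
      then show ?thesis by simp
    qed
    then show ?case using B[of "\<zero>\<^bsub>Env\<^esub>" 0] by (simp add: free_module_simps)
  next
    case (smult_basis r i)
    have "I.pure x (r \<odot>\<^bsub>kZ2\<^esub> free_basis K i) = elt (r \<odot>\<^bsub>Env\<^esub> x) i"
      using smult_basis by (simp add: I.pure_simps)
    then show ?case using smult_basis B by simp
  next
    case (add f g)
    then show ?case using 2(2) by (simp add: I.pure_simps)
  qed
  from 2(3) show ?case
    by (induction rule: I.tensor_induct) (use 2(2) H in auto)
qed (auto simp: I.pure_simps)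

lemma IE_mult_summand_linear:
  assumes "i \<in> carrier Z2" "j \<in> carrier Z2"
  shows "x \<in> carrier Env \<Longrightarrow>
      linear_map K Env I.T (\<lambda>y. I.pure (x \<otimes>\<^bsub>Env\<^esub> (\<tau> ^^ nat i) y) (free_basis K (i \<otimes>\<^bsub>Z2\<^esub> j)))"
    and "y \<in> carrier Env \<Longrightarrow>
      linear_map K Env I.T (\<lambda>x. I.pure (x \<otimes>\<^bsub>Env\<^esub> (\<tau> ^^ nat i) y) (free_basis K (i \<otimes>\<^bsub>Z2\<^esub> j)))"
proof -
  have ij: "i \<otimes>\<^bsub>Z2\<^esub> j \<in> carrier Z2" using assms by auto
  show "linear_map K Env I.T (\<lambda>y. I.pure (x \<otimes>\<^bsub>Env\<^esub> (\<tau> ^^ nat i) y) (free_basis K (i \<otimes>\<^bsub>Z2\<^esub> j)))"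
    if "x \<in> carrier Env"
    by (intro linear_map_comp[OF _ I.pure_linear(2)]
        linear_map_comp[OF flip_power_linear bilinear_mapD(1)[OF Env.mult_bilinear that]]
        free_basis_closed ij)
  show "linear_map K Env I.T (\<lambda>x. I.pure (x \<otimes>\<^bsub>Env\<^esub> (\<tau> ^^ nat i) y) (free_basis K (i \<otimes>\<^bsub>Z2\<^esub> j)))"
    if "y \<in> carrier Env"
    by (intro linear_map_comp[OF _ I.pure_linear(2)] bilinear_mapD(2)[OF Env.mult_bilinear]
        linear_mapD(1)[OF flip_power_linear that] free_basis_closed ij)
qed

lemma IE_mult_bilinear:
  defines "\<mu> \<equiv> \<lambda>x u y v. free_lift K I.T (\<lambda>i. free_lift K I.T (\<lambda>j.
    I.pure (x \<otimes>\<^bsub>Env\<^esub> (\<tau> ^^ nat i) y) (free_basis K (i \<otimes>\<^bsub>Z2\<^esub> j))) v) u"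
  shows "\<And>x u. x \<in> carrier Env \<Longrightarrow> u \<in> carrier kZ2 \<Longrightarrow> bilinear_map K Env kZ2 I.T (\<mu> x u)"
    and "\<And>y v. y \<in> carrier Env \<Longrightarrow> v \<in> carrier kZ2 \<Longrightarrow>
      bilinear_map K Env kZ2 I.T (\<lambda>x u. \<mu> x u y v)"
proof -
  note m = Env.module_axioms free_module_module
  note cl = linear_mapD(1)[OF IE_mult_summand_linear(1)]
  have inner: "(\<lambda>i. free_lift K I.T (\<lambda>j.
      I.pure (x \<otimes>\<^bsub>Env\<^esub> (\<tau> ^^ nat i) y) (free_basis K (i \<otimes>\<^bsub>Z2\<^esub> j))) v) \<in> carrier Z2 \<rightarrow> carrier I.T"
    if "x \<in> carrier Env" "y \<in> carrier Env" "v \<in> carrier kZ2" for x y v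
    using that by (intro Pi_I linear_mapD(1)[OF I.T.free_lift_linear] cl)
  show "bilinear_map K Env kZ2 I.T (\<mu> x u)" if "x \<in> carrier Env" "u \<in> carrier kZ2" for x u
    unfolding \<mu>_def
    by (rule bilinear_mapI)
      (rule I.T.linear_map_free_lift_param[OF that(2)],
        use that m in \<open>auto intro!: I.T.free_lift_linear I.T.linear_map_free_lift_param
          IE_mult_summand_linear cl simp del: mem_carrier_Z2 mult_integer_mod_group\<close>)+
  show "bilinear_map K Env kZ2 I.T (\<lambda>x u. \<mu> x u y v)" if "y \<in> carrier Env" "v \<in> carrier kZ2" for y v
    unfolding \<mu>_def
  proof (rule bilinear_mapI)
    fix x assume "x \<in> carrier Env"
    then show "linear_map K kZ2 I.T (\<lambda>u. free_lift K I.T (\<lambda>i. free_lift K I.T (\<lambda>j.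
        I.pure (x \<otimes>\<^bsub>Env\<^esub> (\<tau> ^^ nat i) y) (free_basis K (i \<otimes>\<^bsub>Z2\<^esub> j))) v) u)"
      by (intro I.T.free_lift_linear inner that)
  next
    fix u assume "u \<in> carrier kZ2"
    then show "linear_map K Env I.T (\<lambda>x. free_lift K I.T (\<lambda>i. free_lift K I.T (\<lambda>j.
        I.pure (x \<otimes>\<^bsub>Env\<^esub> (\<tau> ^^ nat i) y) (free_basis K (i \<otimes>\<^bsub>Z2\<^esub> j))) v) u)"
      by (rule I.T.linear_map_free_lift_param)
        (intro I.T.linear_map_free_lift_param[OF that(2)] m IE_mult_summand_linear that; assumption)+
  qed
qed

lemma IE_mult_eq:
  "X \<otimes>\<^bsub>IE\<^esub> Y = tensor_lift K I.T (\<lambda>x u. tensor_lift K I.T (\<lambda>y v. free_lift K I.T (\<lambda>i.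
      free_lift K I.T (\<lambda>j. I.pure (x \<otimes>\<^bsub>Env\<^esub> (\<tau> ^^ nat i) y) (free_basis K (i \<otimes>\<^bsub>Z2\<^esub> j))) v) u) Y) X"
  by (simp add: involutive_enveloping_algebra_def Let_def)

lemma IE_bilinear: "bilinear_map K I.T I.T I.T (\<lambda>X Y. X \<otimes>\<^bsub>IE\<^esub> Y)"
  unfolding IE_mult_eq
  by (rule I.tensor_product_bilinear_extension(1)[OF IE_mult_bilinear])

lemma elt_closed [simp]: "x \<in> carrier Env \<Longrightarrow> i \<in> carrier Z2 \<Longrightarrow> elt x i \<in> carrier I.T"
  by (intro I.pure_simps free_basis_closed)

lemma elt_mult:
  assumes "x \<in> carrier Env" "y \<in> carrier Env" "i \<in> carrier Z2" "j \<in> carrier Z2"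
  shows "elt x i \<otimes>\<^bsub>IE\<^esub> elt y j = elt (x \<otimes>\<^bsub>Env\<^esub> (\<tau> ^^ nat i) y) ((i + j) mod 2)"
proof -
  have ij: "i' \<otimes>\<^bsub>Z2\<^esub> j' \<in> carrier Z2" if "i' \<in> carrier Z2" "j' \<in> carrier Z2" for i' j'
    using that by auto
  have 1: "free_lift K I.T (\<lambda>j. elt (x \<otimes>\<^bsub>Env\<^esub> (\<tau> ^^ nat i) y) (i \<otimes>\<^bsub>Z2\<^esub> j)) (free_basis K j) =
      elt (x \<otimes>\<^bsub>Env\<^esub> (\<tau> ^^ nat i) y) (i \<otimes>\<^bsub>Z2\<^esub> j)"
    by (rule I.T.free_lift_basis) (intro elt_closed Env.A.m_closed assms linear_mapD(1)[OF flip_power_linear] ij)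
  have 2: "free_lift K I.T (\<lambda>i. free_lift K I.T
      (\<lambda>j. elt (x \<otimes>\<^bsub>Env\<^esub> (\<tau> ^^ nat i) y) (i \<otimes>\<^bsub>Z2\<^esub> j)) (free_basis K j)) (free_basis K i) =
      elt (x \<otimes>\<^bsub>Env\<^esub> (\<tau> ^^ nat i) y) (i \<otimes>\<^bsub>Z2\<^esub> j)"
    unfolding 1[symmetric]
    by (rule I.T.free_lift_basis, unfold 1)
      (intro elt_closed Env.A.m_closed assms linear_mapD(1)[OF flip_power_linear] ij)
  have "elt x i \<otimes>\<^bsub>IE\<^esub> elt y j = free_lift K I.T (\<lambda>i. free_lift K I.T
      (\<lambda>j. elt (x \<otimes>\<^bsub>Env\<^esub> (\<tau> ^^ nat i) y) (i \<otimes>\<^bsub>Z2\<^esub> j)) (free_basis K j)) (free_basis K i)"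
    unfolding IE_mult_eq
    by (rule I.tensor_product_bilinear_extension(2)[OF IE_mult_bilinear])
      (assumption | intro assms free_basis_closed)+
  with 2 show ?thesis by simp
qed

lemma IE_ring: "ring IE"
proof (rule ring_of_generators[OF _ elt_additive_generators])
  show "abelian_group IE"
    by (rule module.axioms(2)[OF module_cong[OF I.tensor_product_module]]) simp_all
  note lin = linear_mapD[OF bilinear_mapD(1)[OF IE_bilinear]]
    linear_mapD[OF bilinear_mapD(2)[OF IE_bilinear]]
  show "x \<otimes>\<^bsub>IE\<^esub> y \<in> carrier IE" if "x \<in> carrier IE" "y \<in> carrier IE" for x y
    using that by (simp add: lin)
  fix x y z assume "x \<in> carrier IE" "y \<in> carrier IE" "z \<in> carrier IE"
  then show "(x \<oplus>\<^bsub>IE\<^esub> y) \<otimes>\<^bsub>IE\<^esub> z = x \<otimes>\<^bsub>IE\<^esub> z \<oplus>\<^bsub>IE\<^esub> y \<otimes>\<^bsub>IE\<^esub> z"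
    and "z \<otimes>\<^bsub>IE\<^esub> (x \<oplus>\<^bsub>IE\<^esub> y) = z \<otimes>\<^bsub>IE\<^esub> x \<oplus>\<^bsub>IE\<^esub> z \<otimes>\<^bsub>IE\<^esub> y"
    by (simp_all add: lin)
next
  let ?B = "{elt x i | x i. x \<in> carrier Env \<and> i \<in> carrier Z2}"
  show "\<one>\<^bsub>IE\<^esub> \<in> carrier IE" by simp
  fix b assume "b \<in> ?B"
  then obtain x i where b: "b = elt x i" "x \<in> carrier Env" "i \<in> carrier Z2" by blast
  have "(\<tau> ^^ nat i) \<one>\<^bsub>Env\<^esub> = \<one>\<^bsub>Env\<^esub>" using b by (auto simp: flip_one)
  with b show "\<one>\<^bsub>IE\<^esub> \<otimes>\<^bsub>IE\<^esub> b = b" "b \<otimes>\<^bsub>IE\<^esub> \<one>\<^bsub>IE\<^esub> = b"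
    by (auto simp: elt_mult)
  fix c d assume "c \<in> ?B" "d \<in> ?B"
  then obtain y j z k where c: "c = elt y j" "y \<in> carrier Env" "j \<in> carrier Z2"
    and d: "d = elt z k" "z \<in> carrier Env" "k \<in> carrier Z2" by blast
  show "b \<otimes>\<^bsub>IE\<^esub> c \<otimes>\<^bsub>IE\<^esub> d = b \<otimes>\<^bsub>IE\<^esub> (c \<otimes>\<^bsub>IE\<^esub> d)"
    using b c d
    by (auto simp: elt_mult flip_mult flip_flip flip_simps Env.A.m_assoc)
qed

abbreviation "gen a b i \<equiv> elt (E.pure a b) i"

lemma gen_add:
  assumes "a \<in> carrier A" "b \<in> carrier A" "c \<in> carrier A" "i \<in> carrier Z2"
  shows "gen (a \<oplus>\<^bsub>A\<^esub> c) b i = gen a b i \<oplus>\<^bsub>I.T\<^esub> gen c b i"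
    and "gen a (b \<oplus>\<^bsub>A\<^esub> c) i = gen a b i \<oplus>\<^bsub>I.T\<^esub> gen a c i"
  using assms by (simp_all add: Env_pure_add I.pure_simps)

lemma gen_smult:
  assumes "r \<in> carrier K" "a \<in> carrier A" "b \<in> carrier A" "i \<in> carrier Z2"
  shows "gen (r \<odot>\<^bsub>A\<^esub> a) b i = r \<odot>\<^bsub>I.T\<^esub> gen a b i"
    and "gen a (r \<odot>\<^bsub>A\<^esub> b) i = r \<odot>\<^bsub>I.T\<^esub> gen a b i"
  using assms by (simp_all add: Env_pure_smult I.pure_simps)

lemma gen_mult:
  assumes "a \<in> carrier A" "b \<in> carrier A" "c \<in> carrier A" "d \<in> carrier A" "i \<in> carrier Z2"
  shows "gen a b 0 \<otimes>\<^bsub>IE\<^esub> gen c d i = gen (a \<otimes>\<^bsub>A\<^esub> c) (d \<otimes>\<^bsub>A\<^esub> b) i"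
    and "gen a b 1 \<otimes>\<^bsub>IE\<^esub> gen c d i =
      gen (a \<otimes>\<^bsub>A\<^esub> star A d) (star A c \<otimes>\<^bsub>A\<^esub> b) (1 - i)"
  using assms unfolding mem_carrier_Z2
  by (elim disjE; simp add: elt_mult flip_pure Env_mult star_closed)+

lemma IE_induct [consumes 1, case_names gen add]:
  assumes "z \<in> carrier I.T"
    and gen: "\<And>a b i. a \<in> carrier A \<Longrightarrow> b \<in> carrier A \<Longrightarrow> i \<in> carrier Z2 \<Longrightarrow> P (gen a b i)"
    and add: "\<And>x y. x \<in> carrier I.T \<Longrightarrow> y \<in> carrier I.T \<Longrightarrow> P x \<Longrightarrow> P y \<Longrightarrow> P (x \<oplus>\<^bsub>I.T\<^esub> y)"
  shows "P z"
proof -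
  have P: "P (elt x i)" if "x \<in> carrier Env" "i \<in> carrier Z2" for x i
    using that
  proof (induction rule: Env_induct)
    case (add x y)
    then show ?case using assms(3)[of "elt x i" "elt y i"] by (simp add: I.pure_simps)
  qed (rule gen)
  have "z \<in> carrier IE" using assms(1) by simp
  with elt_additive_generators show ?thesis
    by (induction rule: additive_generators_induct) (use P add in auto)
qed

end

section \<open>Bimodules as modules over the enveloping algebra\<close>

definition enveloping_action ::
  "('k, 'x) ring_scheme \<Rightarrow> ('k, 'a, 'y) involutive_space_scheme \<Rightarrow>
    ('k, 'a, 'm, 'z) involutive_bimod_scheme \<Rightarrow>
    ('k, ('k, 'a, 'a) tensor, int \<Rightarrow> 'k) tensor \<Rightarrow> 'm \<Rightarrow> 'm" where
  "enveloping_action K A M z m =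
    tensor_lift K M (\<lambda>x u. free_lift K M (\<lambda>i.
      tensor_lift K M (\<lambda>a b. lact M a (ract M ((star M ^^ nat i) m) b)) x) u) z"

definition module_of_bimodule ::
  "('k, 'x) ring_scheme \<Rightarrow> ('k, 'a, 'y) involutive_space_scheme \<Rightarrow>
    ('k, 'a, 'm, 'z) involutive_bimod_scheme \<Rightarrow>
    (('k, ('k, 'a, 'a) tensor, int \<Rightarrow> 'k) tensor, 'm) module" where
  "module_of_bimodule K A M =
    \<lparr>carrier = carrier M, monoid.mult = undefined, one = undefined,
     zero = \<zero>\<^bsub>M\<^esub>, add = add M, smult = enveloping_action K A M\<rparr>"

context involutive_bimodule
begin

lemma star_ract:
  assumes "a \<in> carrier A" "m \<in> carrier M"
  shows "star M (ract M m a) = lact M (star A a) (star M m)"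
proof -
  have "star M (lact M (star A a) (star M m)) = ract M m a"
    using assms by (simp add: star_lact A.star_closed A.star_star M.star_closed M.star_star)
  then show ?thesis
    using assms by (metis A.star_closed M.star_closed M.star_star lact_closed)
qed

lemma star_power_linear: "linear_map K M M (star M ^^ n)"
proof (induction n)
  case (Suc n)
  have "linear_map K M M (star M)"
    by (simp add: linear_mapI M.star_closed M.star_add M.star_smult)
  then show ?case using linear_map_comp[OF Suc] by (simp add: comp_def)
qed (simp add: linear_map_def)

lemma sandwich_linear:
  shows "m \<in> carrier M \<Longrightarrow> bilinear_map K A A M (\<lambda>a b. lact M a (ract M m b))"
    and "a \<in> carrier A \<Longrightarrow> b \<in> carrier A \<Longrightarrow> linear_map K M M (\<lambda>m. lact M a (ract M m b))"
  by (auto intro!: bilinear_mapI linear_mapI simp: lact_closed ract_closed lact_add_left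
      lact_add_right lact_smult_left lact_smult_right ract_add_left ract_add_right
      ract_smult_left ract_smult_right)

abbreviation "env_act x m \<equiv> tensor_lift K M (\<lambda>a b. lact M a (ract M m b)) x"

lemma env_act_linear:
  shows "m \<in> carrier M \<Longrightarrow> linear_map K A.Env M (\<lambda>x. env_act x m)"
    and "x \<in> carrier A.Env \<Longrightarrow> linear_map K M M (\<lambda>m. env_act x m)"
proof -
  show "linear_map K A.Env M (\<lambda>x. env_act x m)" if "m \<in> carrier M"
    unfolding A.Env_linear
    by (intro A.E.tensor_lift_linear M.module_axioms) (simp add: A.bilinear_opposite sandwich_linear that)
  show "linear_map K M M (\<lambda>m. env_act x m)" if "x \<in> carrier A.Env"
    using that
    by (intro A.E.linear_map_tensor_lift_param M.module_axioms)
      (simp_all add: A.bilinear_opposite sandwich_linear A.Env_eq)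
qed

lemma env_act_pure:
  "\<lbrakk>a \<in> carrier A; b \<in> carrier A; m \<in> carrier M\<rbrakk> \<Longrightarrow>
    env_act (A.E.pure a b) m = lact M a (ract M m b)"
  by (subst A.E.tensor_lift_pure[OF M.module_axioms]) (simp_all add: A.bilinear_opposite sandwich_linear)

lemma action_bilinear:
  assumes "m \<in> carrier M"
  shows "bilinear_map K A.Env A.kZ2 M (\<lambda>x u. free_lift K M (\<lambda>i. env_act x ((star M ^^ nat i) m)) u)"
proof (rule bilinear_mapI)
  have c: "(star M ^^ n) m \<in> carrier M" for n
    by (rule linear_mapD(1)[OF star_power_linear assms])
  fix x assume "x \<in> carrier A.Env"
  then show "linear_map K A.kZ2 M (\<lambda>u. free_lift K M (\<lambda>i. env_act x ((star M ^^ nat i) m)) u)"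
    by (intro M.free_lift_linear Pi_I linear_mapD(1)[OF env_act_linear(1)] c)
next
  have c: "(star M ^^ n) m \<in> carrier M" for n
    by (rule linear_mapD(1)[OF star_power_linear assms])
  fix u assume "u \<in> carrier A.kZ2"
  then show "linear_map K A.Env M (\<lambda>x. free_lift K M (\<lambda>i. env_act x ((star M ^^ nat i) m)) u)"
    by (intro M.linear_map_free_lift_param A.Env.module_axioms env_act_linear(1) c)
qed

abbreviation "act \<equiv> enveloping_action K A M"

lemma act_linear:
  shows "m \<in> carrier M \<Longrightarrow> linear_map K A.I.T M (\<lambda>z. act z m)"
    and "z \<in> carrier A.I.T \<Longrightarrow> linear_map K M M (act z)"
proof -
  show "linear_map K A.I.T M (\<lambda>z. act z m)" if "m \<in> carrier M"
    unfolding enveloping_action_def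
    by (intro A.I.tensor_lift_linear M.module_axioms action_bilinear that)
  show "linear_map K M M (act z)" if "z \<in> carrier A.I.T"
    unfolding enveloping_action_def
  proof (intro A.I.linear_map_tensor_lift_param M.module_axioms action_bilinear that)
    fix x u assume "x \<in> carrier A.Env" "u \<in> carrier A.kZ2"
    then show "linear_map K M M (\<lambda>m. free_lift K M (\<lambda>i. env_act x ((star M ^^ nat i) m)) u)"
      by (intro M.linear_map_free_lift_param M.module_axioms
          linear_map_comp[OF star_power_linear env_act_linear(2)])
  qed
qed

lemmas act_simps = linear_mapD[OF act_linear(1)] linear_mapD[OF act_linear(2)]

lemma act_gen:
  assumes "a \<in> carrier A" "b \<in> carrier A" "i \<in> carrier Z2" "m \<in> carrier M"
  shows "act (A.gen a b i) m = lact M a (ract M ((star M ^^ nat i) m) b)"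
proof -
  have c: "(star M ^^ nat i) m \<in> carrier M" for i
    by (rule linear_mapD(1)[OF star_power_linear assms(4)])
  have "act (A.gen a b i) m =
      free_lift K M (\<lambda>i. env_act (A.E.pure a b) ((star M ^^ nat i) m)) (free_basis K i)"
    unfolding enveloping_action_def
    by (rule A.I.tensor_lift_pure) (intro M.module_axioms action_bilinear assms A.Env_pure_closed A.free_basis_closed)+
  also have "\<dots> = env_act (A.E.pure a b) ((star M ^^ nat i) m)"
    by (rule M.free_lift_basis) (intro linear_mapD(1)[OF env_act_linear(1)] c A.Env_pure_closed assms)
  finally show ?thesis using assms c by (simp add: env_act_pure)
qed

lemma act_mult_gen:
  assumes "a \<in> carrier A" "b \<in> carrier A" "i \<in> carrier Z2"
    "c \<in> carrier A" "d \<in> carrier A" "j \<in> carrier Z2" "m \<in> carrier M"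
  shows "act (A.gen a b i \<otimes>\<^bsub>A.IE\<^esub> A.gen c d j) m = act (A.gen a b i) (act (A.gen c d j) m)"
proof -
  from assms(3,6) have "i = 0 \<or> i = 1" "j = 0 \<or> j = 1" by simp_all
  then show ?thesis
    using assms
    by (elim disjE; simp add: A.gen_mult act_gen A.star_closed M.star_closed lact_closed ract_closed
        lact_mult ract_mult star_lact star_ract M.star_star lact_ract)
qed

lemma act_mult:
  assumes "z \<in> carrier A.I.T" "w \<in> carrier A.I.T" "m \<in> carrier M"
  shows "act (z \<otimes>\<^bsub>A.IE\<^esub> w) m = act z (act w m)"
proof -
  interpret IE: ring A.IE by (rule A.IE_ring)
  have cl [simp]: "x \<otimes>\<^bsub>A.IE\<^esub> y \<in> carrier A.I.T" if "x \<in> carrier A.I.T" "y \<in> carrier A.I.T" for x y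
    using IE.m_closed that by simp
  have dist: "(x \<oplus>\<^bsub>A.I.T\<^esub> y) \<otimes>\<^bsub>A.IE\<^esub> z = x \<otimes>\<^bsub>A.IE\<^esub> z \<oplus>\<^bsub>A.I.T\<^esub> y \<otimes>\<^bsub>A.IE\<^esub> z"
    "z \<otimes>\<^bsub>A.IE\<^esub> (x \<oplus>\<^bsub>A.I.T\<^esub> y) = z \<otimes>\<^bsub>A.IE\<^esub> x \<oplus>\<^bsub>A.I.T\<^esub> z \<otimes>\<^bsub>A.IE\<^esub> y"
    if "x \<in> carrier A.I.T" "y \<in> carrier A.I.T" "z \<in> carrier A.I.T" for x y z
    using IE.l_distr[of x y z] IE.r_distr[of x y z] that by simp_all
  show ?thesis
    using assms
  proof (induction arbitrary: w rule: A.IE_induct)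
    case (gen a b i)
    from gen(4,1-3,5) show ?case
      by (induction rule: A.IE_induct) (simp_all add: act_mult_gen dist act_simps)
  qed (simp add: dist act_simps)
qed

lemma module_of_bimodule_left_module: "left_module A.IE (module_of_bimodule K A M)"
proof -
  have "abelian_group (module_of_bimodule K A M)"
    by (rule abelian_group_cong[OF M.abelian_group_axioms]) (simp_all add: module_of_bimodule_def)
  then show ?thesis
    by (auto intro!: left_module.intro left_module_axioms.intro A.IE_ring
        simp: module_of_bimodule_def act_simps act_mult act_gen A.Env_one lact_one ract_one)
qed

end

lemma module_of_bimodule_hom:
  assumes "involutive_bimodule K A M" "involutive_bimodule K A N"
    and f: "f \<in> involutive_bimodule_hom K A M N"
  shows "f \<in> left_module_hom (involutive_enveloping_algebra K A)
    (module_of_bimodule K A M) (module_of_bimodule K A N)"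
proof -
  interpret M: involutive_bimodule K A M by fact
  interpret N: involutive_bimodule K A N by fact
  have f': "f \<in> carrier M \<rightarrow>\<^sub>E carrier N"
    "\<And>m n. m \<in> carrier M \<Longrightarrow> n \<in> carrier M \<Longrightarrow> f (m \<oplus>\<^bsub>M\<^esub> n) = f m \<oplus>\<^bsub>N\<^esub> f n"
    "\<And>a m. a \<in> carrier A \<Longrightarrow> m \<in> carrier M \<Longrightarrow> f (lact M a m) = lact N a (f m)"
    "\<And>a m. a \<in> carrier A \<Longrightarrow> m \<in> carrier M \<Longrightarrow> f (ract M m a) = ract N (f m) a"
    "\<And>m. m \<in> carrier M \<Longrightarrow> f (star M m) = star N (f m)"
    using f by (auto simp: involutive_bimodule_hom_def)
  have fc: "f m \<in> carrier N" if "m \<in> carrier M" for m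
    using f' that by blast
  have "f (M.act z m) = N.act z (f m)" if "z \<in> carrier M.A.I.T" "m \<in> carrier M" for z m
    using that
  proof (induction rule: M.A.IE_induct)
    case (gen a b i)
    then have "i = 0 \<or> i = 1" by simp
    then show ?case
      using gen by (elim disjE; simp add: M.act_gen N.act_gen f' fc M.ract_closed M.M.star_closed)
  qed (simp add: M.act_simps N.act_simps f' fc)
  with f' show ?thesis by (simp add: left_module_hom_def module_of_bimodule_def)
qed

section \<open>Modules over the enveloping algebra as bimodules\<close>

definition bimodule_of_module ::
  "('k, 'x) ring_scheme \<Rightarrow> ('k, 'a, 'y) involutive_space_scheme \<Rightarrow>
    (('k, ('k, 'a, 'a) tensor, int \<Rightarrow> 'k) tensor, 'm, 'z) module_scheme \<Rightarrow>
    ('k, 'a, 'm) involutive_bimod" where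
  "bimodule_of_module K A N =
    (let g = (\<lambda>a b i. pure_tensor K (enveloping_algebra K A) (free_module K (carrier Z2))
        (pure_tensor K A (opposite A) a b) (free_basis K i)) in
    \<lparr>carrier = carrier N, monoid.mult = undefined, one = undefined,
     zero = \<zero>\<^bsub>N\<^esub>, add = add N,
     smult = (\<lambda>r m. g (r \<odot>\<^bsub>A\<^esub> \<one>\<^bsub>A\<^esub>) \<one>\<^bsub>A\<^esub> 0 \<odot>\<^bsub>N\<^esub> m),
     star = (\<lambda>m. g \<one>\<^bsub>A\<^esub> \<one>\<^bsub>A\<^esub> 1 \<odot>\<^bsub>N\<^esub> m),
     lact = (\<lambda>a m. g a \<one>\<^bsub>A\<^esub> 0 \<odot>\<^bsub>N\<^esub> m),
     ract = (\<lambda>m b. g \<one>\<^bsub>A\<^esub> b 0 \<odot>\<^bsub>N\<^esub> m)\<rparr>)"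

context involutive_algebra
begin

lemma bimodule_of_module_simps [simp]:
  "carrier (bimodule_of_module K A N) = carrier N"
  "zero (bimodule_of_module K A N) = zero N"
  "add (bimodule_of_module K A N) = add N"
  "r \<odot>\<^bsub>bimodule_of_module K A N\<^esub> m = gen (r \<odot>\<^bsub>A\<^esub> \<one>\<^bsub>A\<^esub>) \<one>\<^bsub>A\<^esub> 0 \<odot>\<^bsub>N\<^esub> m"
  "star (bimodule_of_module K A N) m = gen \<one>\<^bsub>A\<^esub> \<one>\<^bsub>A\<^esub> 1 \<odot>\<^bsub>N\<^esub> m"
  "lact (bimodule_of_module K A N) a m = gen a \<one>\<^bsub>A\<^esub> 0 \<odot>\<^bsub>N\<^esub> m"
  "ract (bimodule_of_module K A N) m b = gen \<one>\<^bsub>A\<^esub> b 0 \<odot>\<^bsub>N\<^esub> m"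
  by (simp_all add: bimodule_of_module_def)

lemma bimodule_of_module_involutive_bimodule:
  assumes "left_module IE N"
  shows "involutive_bimodule K A (bimodule_of_module K A N)"
proof -
  interpret N: left_module IE N by fact
  let ?B = "bimodule_of_module K A N"
  have closed: "gen a b i \<odot>\<^bsub>N\<^esub> m \<in> carrier N"
    if "a \<in> carrier A" "b \<in> carrier A" "i \<in> carrier Z2" "m \<in> carrier N" for a b i m
    using that by (intro N.smult_closed) auto
  have comp: "gen a b 0 \<odot>\<^bsub>N\<^esub> (gen c d i \<odot>\<^bsub>N\<^esub> m) = gen (a \<otimes>\<^bsub>A\<^esub> c) (d \<otimes>\<^bsub>A\<^esub> b) i \<odot>\<^bsub>N\<^esub> m"
    "gen a b 1 \<odot>\<^bsub>N\<^esub> (gen c d i \<odot>\<^bsub>N\<^esub> m) =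
      gen (a \<otimes>\<^bsub>A\<^esub> star A d) (star A c \<otimes>\<^bsub>A\<^esub> b) (1 - i) \<odot>\<^bsub>N\<^esub> m"
    if "a \<in> carrier A" "b \<in> carrier A" "c \<in> carrier A" "d \<in> carrier A" "i \<in> carrier Z2"
      "m \<in> carrier N" for a b c d i m
    using that N.smult_assoc[of "gen a b 0" "gen c d i" m] N.smult_assoc[of "gen a b 1" "gen c d i" m]
    by (simp_all add: gen_mult del: mem_carrier_Z2 add: mem_carrier_Z2[of 0] mem_carrier_Z2[of 1])
  have add: "gen (a \<oplus>\<^bsub>A\<^esub> c) b i \<odot>\<^bsub>N\<^esub> m = gen a b i \<odot>\<^bsub>N\<^esub> m \<oplus>\<^bsub>N\<^esub> gen c b i \<odot>\<^bsub>N\<^esub> m"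
    "gen a (b \<oplus>\<^bsub>A\<^esub> c) i \<odot>\<^bsub>N\<^esub> m = gen a b i \<odot>\<^bsub>N\<^esub> m \<oplus>\<^bsub>N\<^esub> gen a c i \<odot>\<^bsub>N\<^esub> m"
    if "a \<in> carrier A" "b \<in> carrier A" "c \<in> carrier A" "i \<in> carrier Z2" "m \<in> carrier N" for a b c i m
    using that N.smult_l_distr[of "gen a b i" "gen c b i" m]
      N.smult_l_distr[of "gen a b i" "gen a c i" m]
    by (simp_all add: gen_add del: mem_carrier_Z2)
  have one: "gen \<one>\<^bsub>A\<^esub> \<one>\<^bsub>A\<^esub> 0 \<odot>\<^bsub>N\<^esub> m = m" if "m \<in> carrier N" for m
    using N.smult_one[OF that] by (simp add: Env_one)
  have B: "module K ?B"
  proof (intro moduleI is_cring)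
    show "abelian_group ?B"
      by (rule abelian_group_cong[OF N.M.abelian_group_axioms]) simp_all
  qed (auto simp: closed comp add one N.smult_r_distr smult_l_distr smult_assoc1 smult_mult_left)
  have scal: "gen (r \<odot>\<^bsub>A\<^esub> a) b i = gen a (r \<odot>\<^bsub>A\<^esub> b) i"
    if "r \<in> carrier K" "a \<in> carrier A" "b \<in> carrier A" "i \<in> carrier Z2" for r a b i
    using that by (simp add: gen_smult del: mem_carrier_Z2)
  show ?thesis
    by (intro involutive_bimodule.intro involutive_bimodule_axioms.intro involutive_vector_space.intro
        involutive_vector_space_axioms.intro B involutive_algebra_axioms field_axioms)
      (auto simp: closed comp add one N.smult_r_distr smult_mult_left smult_mult_right scal
        star_one star_smult star_closed)
qed

end

section \<open>The equivalence\<close>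

lemma PiE_imp_Pi: "f \<in> A \<rightarrow>\<^sub>E B \<Longrightarrow> f \<in> A \<rightarrow> B"
  by (simp add: PiE_def)

lemma compose_closed: "f \<in> A \<rightarrow>\<^sub>E B \<Longrightarrow> g \<in> B \<rightarrow>\<^sub>E C \<Longrightarrow> compose A g f \<in> A \<rightarrow>\<^sub>E C"
  by (auto simp: compose_def PiE_iff)

lemma compose_restrict_id:
  assumes "f \<in> A \<rightarrow>\<^sub>E B"
  shows "compose A f (\<lambda>x\<in>A. x) = f" and "compose A (\<lambda>x\<in>B. x) f = f"
  using assms by (auto simp: compose_def PiE_iff extensional_def fun_eq_iff)

lemma compose_restrict_id_id: "compose A (\<lambda>x\<in>A. x) (\<lambda>x\<in>A. x) = (\<lambda>x\<in>A. x)"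
  by (simp add: compose_def fun_eq_iff)

lemma hom_extensional:
  "f \<in> involutive_bimodule_hom K A M M' \<Longrightarrow> f \<in> carrier M \<rightarrow>\<^sub>E carrier M'"
  "g \<in> left_module_hom R N N' \<Longrightarrow> g \<in> carrier N \<rightarrow>\<^sub>E carrier N'"
  by (simp_all add: involutive_bimodule_hom_def left_module_hom_def)

lemma involutive_bimodule_hom_compose:
  assumes "f \<in> involutive_bimodule_hom K A L M" "g \<in> involutive_bimodule_hom K A M N"
    and "involutive_bimodule K A L"
  shows "compose (carrier L) g f \<in> involutive_bimodule_hom K A L N"
proof -
  interpret L: involutive_bimodule K A L by fact
  have "\<And>x. x \<in> carrier L \<Longrightarrow> f x \<in> carrier M"
    using assms(1) by (auto simp: involutive_bimodule_hom_def)
  then show ?thesis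
    using assms(1,2) compose_closed[OF hom_extensional(1)[OF assms(1)] hom_extensional(1)[OF assms(2)]]
    by (simp add: involutive_bimodule_hom_def compose_eq L.lact_closed L.ract_closed L.M.star_closed)
qed

lemma left_module_hom_compose:
  assumes "f \<in> left_module_hom R L M" "g \<in> left_module_hom R M N" and "left_module R L"
  shows "compose (carrier L) g f \<in> left_module_hom R L N"
proof -
  interpret L: left_module R L by fact
  have "\<And>x. x \<in> carrier L \<Longrightarrow> f x \<in> carrier M"
    using assms(1) by (auto simp: left_module_hom_def)
  then show ?thesis
    using assms(1,2) compose_closed[OF hom_extensional(2)[OF assms(1)] hom_extensional(2)[OF assms(2)]]
    by (simp add: left_module_hom_def compose_eq L.smult_closed)
qed

lemma restrict_id_bimodule_hom:
  assumes "involutive_bimodule K A M" and "carrier N = carrier M" "add N = add M"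
    and "\<And>r m. r \<in> carrier K \<Longrightarrow> m \<in> carrier M \<Longrightarrow> r \<odot>\<^bsub>N\<^esub> m = r \<odot>\<^bsub>M\<^esub> m"
    and "\<And>a m. a \<in> carrier A \<Longrightarrow> m \<in> carrier M \<Longrightarrow> lact N a m = lact M a m"
    and "\<And>a m. a \<in> carrier A \<Longrightarrow> m \<in> carrier M \<Longrightarrow> ract N m a = ract M m a"
    and "\<And>m. m \<in> carrier M \<Longrightarrow> star N m = star M m"
  shows "(\<lambda>m\<in>carrier M. m) \<in> involutive_bimodule_hom K A M N"
    and "(\<lambda>m\<in>carrier M. m) \<in> involutive_bimodule_hom K A N M"
proof -
  interpret M: involutive_bimodule K A M by fact
  show "(\<lambda>m\<in>carrier M. m) \<in> involutive_bimodule_hom K A M N"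
    "(\<lambda>m\<in>carrier M. m) \<in> involutive_bimodule_hom K A N M"
    using assms(2-) by (simp_all add: involutive_bimodule_hom_def M.lact_closed M.ract_closed M.M.star_closed)
qed

lemma restrict_id_module_hom:
  assumes "left_module R M" and "carrier N = carrier M" "add N = add M"
    and "\<And>r m. r \<in> carrier R \<Longrightarrow> m \<in> carrier M \<Longrightarrow> r \<odot>\<^bsub>N\<^esub> m = r \<odot>\<^bsub>M\<^esub> m"
  shows "(\<lambda>m\<in>carrier M. m) \<in> left_module_hom R M N"
    and "(\<lambda>m\<in>carrier M. m) \<in> left_module_hom R N M"
proof -
  interpret M: left_module R M by fact
  show "(\<lambda>m\<in>carrier M. m) \<in> left_module_hom R M N" "(\<lambda>m\<in>carrier M. m) \<in> left_module_hom R N M"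
    using assms(2-) by (simp_all add: left_module_hom_def M.smult_closed)
qed

lemma involutive_bimodule_category: "category (involutive_bimodule_category K A)"
  by (rule category.intro)
    (auto simp: involutive_bimodule_category_def compose_restrict_id[OF hom_extensional(1)]
      intro: involutive_bimodule_hom_compose restrict_id_bimodule_hom(1)
        compose_assoc[symmetric, OF PiE_imp_Pi[OF hom_extensional(1)]])

lemma left_module_category: "category (left_module_category R)"
  by (rule category.intro)
    (auto simp: left_module_category_def compose_restrict_id[OF hom_extensional(2)]
      intro: left_module_hom_compose restrict_id_module_hom(1)
        compose_assoc[symmetric, OF PiE_imp_Pi[OF hom_extensional(2)]])

context involutive_algebra
begin

lemma bimodule_of_module_hom:
  "f \<in> left_module_hom IE M N \<Longrightarrow>
    f \<in> involutive_bimodule_hom K A (bimodule_of_module K A M) (bimodule_of_module K A N)"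
  by (simp add: left_module_hom_def involutive_bimodule_hom_def)

lemma unit_iso:
  assumes "involutive_bimodule K A M"
  defines "N \<equiv> bimodule_of_module K A (module_of_bimodule K A M)"
  shows "(\<lambda>m\<in>carrier M. m) \<in> involutive_bimodule_hom K A M N"
    and "(\<lambda>m\<in>carrier M. m) \<in> involutive_bimodule_hom K A N M"
proof -
  interpret M: involutive_bimodule K A M by fact
  have *: "smult (module_of_bimodule K A M) = M.act" "carrier (module_of_bimodule K A M) = carrier M"
    "add (module_of_bimodule K A M) = add M"
    by (simp_all add: module_of_bimodule_def)
  show "(\<lambda>m\<in>carrier M. m) \<in> involutive_bimodule_hom K A M N"
    "(\<lambda>m\<in>carrier M. m) \<in> involutive_bimodule_hom K A N M"
    by (rule restrict_id_bimodule_hom[OF assms(1)],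
      simp_all add: N_def * M.act_gen M.lact_smult_left M.lact_one M.ract_one M.M.star_closed
        M.ract_closed)+
qed

lemma counit_iso:
  assumes "left_module IE N"
  defines "M \<equiv> module_of_bimodule K A (bimodule_of_module K A N)"
  shows "(\<lambda>m\<in>carrier N. m) \<in> left_module_hom IE N M"
    and "(\<lambda>m\<in>carrier N. m) \<in> left_module_hom IE M N"
proof -
  interpret N: left_module IE N by fact
  interpret B: involutive_bimodule K A "bimodule_of_module K A N"
    by (rule bimodule_of_module_involutive_bimodule[OF assms(1)])
  have act: "B.act z m = z \<odot>\<^bsub>N\<^esub> m" if "z \<in> carrier I.T" "m \<in> carrier N" for z m
    using that
  proof (induction rule: IE_induct)
    case (gen a b i)
    then have "i = 0 \<or> i = 1" by simp
    then show ?case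
      using gen
        N.smult_assoc[of "gen \<one>\<^bsub>A\<^esub> b 0" "gen \<one>\<^bsub>A\<^esub> \<one>\<^bsub>A\<^esub> 1" m, symmetric]
        N.smult_assoc[of "gen a \<one>\<^bsub>A\<^esub> 0" "gen \<one>\<^bsub>A\<^esub> b 0" m, symmetric]
        N.smult_assoc[of "gen a \<one>\<^bsub>A\<^esub> 0" "gen \<one>\<^bsub>A\<^esub> b 1" m, symmetric]
      by (elim disjE; simp add: B.act_gen gen_mult)
  next
    case (add x y)
    then show ?case using N.smult_l_distr[of x y m] by (simp add: B.act_simps)
  qed
  have *: "smult M = B.act" "carrier M = carrier N" "add M = add N"
    by (simp_all add: M_def module_of_bimodule_def)
  show "(\<lambda>m\<in>carrier N. m) \<in> left_module_hom IE N M" "(\<lambda>m\<in>carrier N. m) \<in> left_module_hom IE M N"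
    by (rule restrict_id_module_hom[OF assms(1)], simp_all add: * act)+
qed

end

theorem proposition2p2p1:
  fixes K :: "'k ring" and A :: "('k, 'a) involutive_space"
  assumes "field K" and "involutive_algebra K A"
  shows "equivalent_categories
    (involutive_bimodule_category K A :: (('k, 'a, 'm) involutive_bimod, 'm \<Rightarrow> 'm) cat)
    (left_module_category (involutive_enveloping_algebra K A) ::
      ((('k, ('k, 'a, 'a) tensor, int \<Rightarrow> 'k) tensor, 'm) module, 'm \<Rightarrow> 'm) cat)"
proof -
  interpret involutive_algebra K A by fact
  let ?C = "involutive_bimodule_category K A :: (('k, 'a, 'm) involutive_bimod, 'm \<Rightarrow> 'm) cat"
  let ?D = "left_module_category IE :: ((_, 'm) module, 'm \<Rightarrow> 'm) cat"
  let ?F = "\<lparr>on_obj = module_of_bimodule K A, on_hom = (\<lambda>X Y f. f)\<rparr>"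
  let ?G = "\<lparr>on_obj = bimodule_of_module K A, on_hom = (\<lambda>X Y f. f)\<rparr>"
  have carrier: "carrier (module_of_bimodule K A M) = carrier M" for M :: "('k, 'a, 'm) involutive_bimod"
    by (simp add: module_of_bimodule_def)
  have "category_functor ?C ?D ?F"
    by (intro category_functor.intro category_functor_axioms.intro involutive_bimodule_category
        left_module_category)
      (auto simp: involutive_bimodule_category_def left_module_category_def carrier
        intro: module_of_bimodule_hom involutive_bimodule.module_of_bimodule_left_module)
  moreover have "category_functor ?D ?C ?G"
    by (intro category_functor.intro category_functor_axioms.intro involutive_bimodule_category
        left_module_category)
      (auto simp: involutive_bimodule_category_def left_module_category_def
        intro: bimodule_of_module_hom bimodule_of_module_involutive_bimodule)
  moreover have "natural_isomorphism ?C ?C id_functor (comp_functor ?G ?F) (\<lambda>M. \<lambda>m\<in>carrier M. m)"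
    unfolding natural_isomorphism_def isomorphisms_def
    by (auto simp: id_functor_def comp_functor_def involutive_bimodule_category_def carrier
        compose_restrict_id[OF hom_extensional(1)] compose_restrict_id_id
        intro!: unit_iso bexI[of _ "\<lambda>m\<in>carrier _. m"])
  moreover have "natural_isomorphism ?D ?D (comp_functor ?F ?G) id_functor (\<lambda>N. \<lambda>m\<in>carrier N. m)"
    unfolding natural_isomorphism_def isomorphisms_def
    by (auto simp: id_functor_def comp_functor_def left_module_category_def carrier
        compose_restrict_id[OF hom_extensional(2)] compose_restrict_id_id
        intro!: counit_iso bexI[of _ "\<lambda>m\<in>carrier _. m"])
  ultimately show ?thesis
    unfolding equivalent_categories_def by blast
qed

end
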